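(* Let $(M^n,g)$ be a Riemannian manifold carrying a conformal product structure with adapted Weyl connection $D$, Lee form $\theta$, and orthogonal $D$-parallel splitting $TM=T_1\oplus T_2$, where $p=\operatorname{rank}T_1\ge 2$ and $q=\operatorname{rank}T_2\ge 2$, $n=p+q$. Then, without any assumption on the Ricci curvature, $$(d\theta)^\sharp=\frac{n-2}{4(p-1)(q-1)}\,[\mathcal K_W,S].$$ Moreover, $$S\Theta^s-\Theta^sS+\theta^\sharp\wedge S\theta^\sharp=\frac{p-q}{n-2}(d\theta)^\sharp+\frac1{n-2}[S,\operatorname{Ric}^\sharp].$$ In particular, if in addition $[\operatorname{Ric}^\sharp,S]=0$, then the last term of the second identity vanishes.
   Context: Let $\nabla$ be the Levi-Civita connection of $g$. A Weyl connection on $(M,g)$ is a connection of the form $D_XY=\nabla_XY+\theta(Y)X+\theta(X)Y-g(X,Y)\theta^\sharp$ for a one-form $\theta$, called its Lee form (equivalently, $D$ is torsion-free with $Dg=-2\theta\otimes g$). A conformal product structure on $(M,g)$ is a $g$-orthogonal splitting $TM=T_1\oplus T_2$ into distributions of constant rank together with a Weyl connection $D$ (the adapted Weyl connection) preserving both $T_1$ and $T_2$. Notation and conventions. $S$ is the orthogonal involution with $S|_{T_1}=\mathrm{Id}$, $S|_{T_2}=-\mathrm{Id}$. $R(X,Y)Z=\nabla_X\nabla_YZ-\nabla_Y\nabla_XZ-\nabla_{[X,Y]}Z$; $\operatorname{Ric}(X,Y)=\sum_i g(R(X,e_i)e_i,Y)$ for an orthonormal frame $\{e_i\}$; $g(\operatorname{Ric}^\sharp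 X,Y)=\operatorname{Ric}(X,Y)$. $W$ is the Weyl tensor of $g$, i.e. the totally trace-free part of $R$, written $W_{X,Y}Z$ with the same sign convention as $R(X,Y)Z$. $\mathcal K_W(X)=\sum_{i=1}^n W_{X,e_i}(Se_i)$ for any local orthonormal frame (this is frame independent). $\Theta$ is the endomorphism $g(\Theta X,Y)=(\nabla_X\theta)(Y)$ and $\Theta^s=\tfrac12(\Theta+\Theta^t)$ is its symmetric part. For a two-form $\omega$, $g(\omega^\sharp X,Y)=\omega(X,Y)$; $d\theta(X,Y)=X\theta(Y)-Y\theta(X)-\theta([X,Y])$. For vectors $u,v$, $(u\wedge v)(X)=g(v,X)u-g(u,X)v$. $[A,B]=AB-BA$. *)

theory Defs
  imports "HOL-Analysis.Analysis" "HOL-Library.Function_Algebras"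
begin

text \<open>Pointwise scaling, so that tangent vectors (functionals on functions) and vector
  fields form real vector spaces, with the pointwise addition of \<^theory>\<open>HOL-Library.Function_Algebras\<close>.\<close>

instantiation "fun" :: (type, real_vector) real_vector
begin

definition scaleR_fun :: "real \<Rightarrow> ('a \<Rightarrow> 'b) \<Rightarrow> 'a \<Rightarrow> 'b" where
  "scaleR_fun r f = (\<lambda>x. r *\<^sub>R f x)"

instance
  by standard (auto simp: scaleR_fun_def fun_eq_iff plus_fun_def scaleR_add_right scaleR_add_left)

end

fun Ck_on :: "nat \<Rightarrow> 'a::real_normed_vector set \<Rightarrow> ('a \<Rightarrow> 'b::real_normed_vector) \<Rightarrow> bool" where
  "Ck_on 0 S f \<longleftrightarrow> continuous_on S f"
| "Ck_on (Suc k) S f \<longleftrightarrow>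
     (\<forall>x\<in>S. f differentiable (at x)) \<and> (\<forall>v. Ck_on k S (\<lambda>x. frechet_derivative f (at x) v))"

definition smooth_on :: "'a::real_normed_vector set \<Rightarrow> ('a \<Rightarrow> 'b::real_normed_vector) \<Rightarrow> bool" where
  "smooth_on S f \<longleftrightarrow> (\<forall>k. Ck_on k S f)"

text \<open>The manifold is the whole type \<open>'m\<close>; a chart is a pair of its domain and its coordinate map.
  The atlas need not be maximal.\<close>

type_synonym ('m, 'e) atlas = "('m set \<times> ('m \<Rightarrow> 'e)) set"

definition smooth_atlas ::
    "('m::{t2_space, second_countable_topology}, 'e::euclidean_space) atlas \<Rightarrow> bool" where
  "smooth_atlas A \<longleftrightarrow>
     (\<Union>(U, \<phi>)\<in>A. U) = UNIV \<and>
     (\<forall>(U, \<phi>)\<in>A. open U \<and> open (\<phi> ` U) \<and> homeomorphism U (\<phi> ` U) \<phi> (inv_into U \<phi>)) \<and>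
     (\<forall>(U, \<phi>)\<in>A. \<forall>(V, \<psi>)\<in>A. smooth_on (\<phi> ` (U \<inter> V)) (\<psi> \<circ> inv_into U \<phi>))"

definition smooth_fun_on ::
    "('m::topological_space, 'e::euclidean_space) atlas \<Rightarrow> 'm set \<Rightarrow> ('m \<Rightarrow> real) \<Rightarrow> bool" where
  "smooth_fun_on A U f \<longleftrightarrow>
     open U \<and> (\<forall>(V, \<phi>)\<in>A. smooth_on (\<phi> ` (U \<inter> V)) (f \<circ> inv_into V \<phi>))"

definition smooth_fun_at ::
    "('m::topological_space, 'e::euclidean_space) atlas \<Rightarrow> 'm \<Rightarrow> ('m \<Rightarrow> real) \<Rightarrow> bool" where
  "smooth_fun_at A x f \<longleftrightarrow> (\<exists>U. x \<in> U \<and> smooth_fun_on A U f)"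

text \<open>Tangent vectors at \<open>x\<close> are the derivations at \<open>x\<close> of the functions that are smooth near \<open>x\<close>.
  Since these functions are total and arbitrary away from \<open>x\<close> (in particular the indicator
  function of the complement of a neighbourhood of \<open>x\<close> is among them), the Leibniz rule forces a
  derivation to depend on germs only.  The value \<open>0\<close> on all other functions makes a tangent
  vector determined by its action on germs.\<close>

type_synonym 'm tvec = "('m \<Rightarrow> real) \<Rightarrow> real"
type_synonym 'm vfield = "'m \<Rightarrow> 'm tvec"

definition tangent_space ::
    "('m::topological_space, 'e::euclidean_space) atlas \<Rightarrow> 'm \<Rightarrow> 'm tvec set" where
  "tangent_space A x = {v.
     (\<forall>f h. smooth_fun_at A x f \<and> smooth_fun_at A x h \<longrightarrow>
        v (\<lambda>y. f y + h y) = v f + v h \<and>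
        v (\<lambda>y. f y * h y) = f x * v h + h x * v f) \<and>
     (\<forall>c f. smooth_fun_at A x f \<longrightarrow> v (\<lambda>y. c * f y) = c * v f) \<and>
     (\<forall>f. \<not> smooth_fun_at A x f \<longrightarrow> v f = 0)}"

definition vfield_on ::
    "('m::topological_space, 'e::euclidean_space) atlas \<Rightarrow> 'm set \<Rightarrow> 'm vfield \<Rightarrow> bool" where
  "vfield_on A U X \<longleftrightarrow> open U \<and> (\<forall>x\<in>U. X x \<in> tangent_space A x) \<and>
     (\<forall>V f. V \<subseteq> U \<and> smooth_fun_on A V f \<longrightarrow> smooth_fun_on A V (\<lambda>x. X x f))"

definition vfield_at ::
    "('m::topological_space, 'e::euclidean_space) atlas \<Rightarrow> 'm \<Rightarrow> 'm vfield \<Rightarrow> bool" where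
  "vfield_at A x X \<longleftrightarrow> (\<exists>U. x \<in> U \<and> vfield_on A U X)"

definition lie_bracket ::
    "('m::topological_space, 'e::euclidean_space) atlas \<Rightarrow> 'm vfield \<Rightarrow> 'm vfield \<Rightarrow> 'm vfield" where
  "lie_bracket A X Y x f =
     (if smooth_fun_at A x f then X x (\<lambda>y. Y y f) - Y x (\<lambda>y. X y f) else 0)"

text \<open>A local vector field through a given tangent vector.  It is only used inside expressions
  that are tensorial, i.e. independent of the extension.\<close>

definition extend ::
    "('m::topological_space, 'e::euclidean_space) atlas \<Rightarrow> 'm \<Rightarrow> 'm tvec \<Rightarrow> 'm vfield" where
  "extend A x v = (SOME X. vfield_at A x X \<and> X x = v)"

type_synonym 'm metric = "'m \<Rightarrow> 'm tvec \<Rightarrow> 'm tvec \<Rightarrow> real"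
type_synonym 'm oneform = "'m \<Rightarrow> 'm tvec \<Rightarrow> real"

definition riemannian_metric ::
    "('m::topological_space, 'e::euclidean_space) atlas \<Rightarrow> 'm metric \<Rightarrow> bool" where
  "riemannian_metric A g \<longleftrightarrow>
     (\<forall>x. \<forall>u\<in>tangent_space A x. \<forall>v\<in>tangent_space A x. \<forall>w\<in>tangent_space A x. \<forall>a.
        g x (a *\<^sub>R u + v) w = a * g x u w + g x v w \<and>
        g x u v = g x v u \<and>
        (u \<noteq> 0 \<longrightarrow> g x u u > 0)) \<and>
     (\<forall>U X Y. vfield_on A U X \<and> vfield_on A U Y \<longrightarrow> smooth_fun_on A U (\<lambda>x. g x (X x) (Y x)))"

definition one_form ::
    "('m::topological_space, 'e::euclidean_space) atlas \<Rightarrow> 'm oneform \<Rightarrow> bool" where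
  "one_form A \<theta> \<longleftrightarrow>
     (\<forall>x. \<forall>u\<in>tangent_space A x. \<forall>v\<in>tangent_space A x. \<forall>a.
        \<theta> x (a *\<^sub>R u + v) = a * \<theta> x u + \<theta> x v) \<and>
     (\<forall>U X. vfield_on A U X \<longrightarrow> smooth_fun_on A U (\<lambda>x. \<theta> x (X x)))"

text \<open>The tangent vector metrically dual to a linear form on the tangent space at \<open>x\<close>.\<close>

definition sharp ::
    "('m::topological_space, 'e::euclidean_space) atlas \<Rightarrow> 'm metric \<Rightarrow> 'm \<Rightarrow> ('m tvec \<Rightarrow> real) \<Rightarrow> 'm tvec" where
  "sharp A g x \<alpha> =
     (THE v. v \<in> tangent_space A x \<and> (\<forall>w\<in>tangent_space A x. g x v w = \<alpha> w))"

text \<open>\<open>D x v Y\<close> is the covariant derivative at \<open>x\<close>, in the direction of the tangent vector \<open>v\<close>, of a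
  vector field \<open>Y\<close> defined near \<open>x\<close>.  As for tangent vectors, the Leibniz rule makes it depend
  on the germ of \<open>Y\<close> only.\<close>

type_synonym 'm conn = "'m \<Rightarrow> 'm tvec \<Rightarrow> 'm vfield \<Rightarrow> 'm tvec"

definition connection ::
    "('m::topological_space, 'e::euclidean_space) atlas \<Rightarrow> 'm conn \<Rightarrow> bool" where
  "connection A D \<longleftrightarrow>
     (\<forall>x Y. vfield_at A x Y \<longrightarrow>
        (\<forall>u\<in>tangent_space A x. D x u Y \<in> tangent_space A x) \<and>
        (\<forall>u\<in>tangent_space A x. \<forall>v\<in>tangent_space A x. \<forall>a.
           D x (a *\<^sub>R u + v) Y = a *\<^sub>R D x u Y + D x v Y) \<and>
        (\<forall>u\<in>tangent_space A x. \<forall>Z. vfield_at A x Z \<longrightarrow>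
           D x u (\<lambda>y. Y y + Z y) = D x u Y + D x u Z) \<and>
        (\<forall>u\<in>tangent_space A x. \<forall>f. smooth_fun_at A x f \<longrightarrow>
           D x u (\<lambda>y. f y *\<^sub>R Y y) = u f *\<^sub>R Y x + f x *\<^sub>R D x u Y)) \<and>
     (\<forall>U X Y. vfield_on A U X \<and> vfield_on A U Y \<longrightarrow> vfield_on A U (\<lambda>x. D x (X x) Y))"

definition levi_civita ::
    "('m::topological_space, 'e::euclidean_space) atlas \<Rightarrow> 'm metric \<Rightarrow> 'm conn \<Rightarrow> bool" where
  "levi_civita A g nabla \<longleftrightarrow> connection A nabla \<and>
     (\<forall>x X Y. vfield_at A x X \<and> vfield_at A x Y \<longrightarrow>
        nabla x (X x) Y - nabla x (Y x) X = lie_bracket A X Y x) \<and>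
     (\<forall>x Y Z. \<forall>u\<in>tangent_space A x. vfield_at A x Y \<and> vfield_at A x Z \<longrightarrow>
        u (\<lambda>y. g y (Y y) (Z y)) = g x (nabla x u Y) (Z x) + g x (Y x) (nabla x u Z))"

definition weyl_connection ::
    "('m::topological_space, 'e::euclidean_space) atlas \<Rightarrow> 'm metric \<Rightarrow> 'm conn \<Rightarrow> 'm conn
      \<Rightarrow> 'm oneform \<Rightarrow> bool" where
  "weyl_connection A g nabla D \<theta> \<longleftrightarrow> connection A D \<and> one_form A \<theta> \<and>
     (\<forall>x Y. \<forall>u\<in>tangent_space A x. vfield_at A x Y \<longrightarrow>
        D x u Y = nabla x u Y + \<theta> x (Y x) *\<^sub>R u + \<theta> x u *\<^sub>R Y x - g x u (Y x) *\<^sub>R sharp A g x (\<theta> x))"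

definition distribution ::
    "('m::topological_space, 'e::euclidean_space) atlas \<Rightarrow> nat \<Rightarrow> ('m \<Rightarrow> 'm tvec set) \<Rightarrow> bool" where
  "distribution A r T \<longleftrightarrow>
     (\<forall>x. subspace (T x) \<and> T x \<subseteq> tangent_space A x \<and> dim (T x) = r) \<and>
     (\<forall>x. \<exists>U (F :: nat \<Rightarrow> 'm vfield). x \<in> U \<and> (\<forall>i<r. vfield_on A U (F i)) \<and>
        (\<forall>y\<in>U. T y = span ((\<lambda>i. F i y) ` {..<r})))"

definition parallel ::
    "('m::topological_space, 'e::euclidean_space) atlas \<Rightarrow> 'm conn \<Rightarrow> ('m \<Rightarrow> 'm tvec set) \<Rightarrow> bool" where
  "parallel A D T \<longleftrightarrow>
     (\<forall>U Y. vfield_on A U Y \<and> (\<forall>x\<in>U. Y x \<in> T x) \<longrightarrow>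
        (\<forall>x\<in>U. \<forall>u\<in>tangent_space A x. D x u Y \<in> T x))"

definition conformal_product ::
    "('m::topological_space, 'e::euclidean_space) atlas \<Rightarrow> 'm metric \<Rightarrow> 'm conn \<Rightarrow> 'm conn
      \<Rightarrow> 'm oneform \<Rightarrow> nat \<Rightarrow> ('m \<Rightarrow> 'm tvec set) \<Rightarrow> nat \<Rightarrow> ('m \<Rightarrow> 'm tvec set) \<Rightarrow> bool" where
  "conformal_product A g nabla D \<theta> p T1 q T2 \<longleftrightarrow>
     distribution A p T1 \<and> distribution A q T2 \<and>
     (\<forall>x. tangent_space A x = {u + v | u v. u \<in> T1 x \<and> v \<in> T2 x}) \<and>
     (\<forall>x. \<forall>u\<in>T1 x. \<forall>v\<in>T2 x. g x u v = 0) \<and>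
     weyl_connection A g nabla D \<theta> \<and> parallel A D T1 \<and> parallel A D T2"

definition involution :: "('m \<Rightarrow> 'm tvec set) \<Rightarrow> ('m \<Rightarrow> 'm tvec set) \<Rightarrow> 'm \<Rightarrow> 'm tvec \<Rightarrow> 'm tvec" where
  "involution T1 T2 x w = (THE w'. \<exists>u\<in>T1 x. \<exists>v\<in>T2 x. w = u + v \<and> w' = u - v)"

definition curvature ::
    "('m::topological_space, 'e::euclidean_space) atlas \<Rightarrow> 'm conn
      \<Rightarrow> 'm \<Rightarrow> 'm tvec \<Rightarrow> 'm tvec \<Rightarrow> 'm tvec \<Rightarrow> 'm tvec" where
  "curvature A nabla x u v w =
     (let X = extend A x u; Y = extend A x v; Z = extend A x w in
        nabla x (X x) (\<lambda>y. nabla y (Y y) Z) - nabla x (Y x) (\<lambda>y. nabla y (X y) Z)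
          - nabla x (lie_bracket A X Y x) Z)"

definition orthonormal_basis ::
    "('m::topological_space, 'e::euclidean_space) atlas \<Rightarrow> 'm metric \<Rightarrow> 'm \<Rightarrow> 'm tvec set \<Rightarrow> bool" where
  "orthonormal_basis A g x B \<longleftrightarrow>
     finite B \<and> span B = tangent_space A x \<and> (\<forall>a\<in>B. \<forall>b\<in>B. g x a b = (if a = b then 1 else 0))"

text \<open>The frame used in the (frame independent) traces below.\<close>

definition frame_at ::
    "('m::topological_space, 'e::euclidean_space) atlas \<Rightarrow> 'm metric \<Rightarrow> 'm \<Rightarrow> 'm tvec set" where
  "frame_at A g x = (SOME B. orthonormal_basis A g x B)"

definition Ric ::
    "('m::topological_space, 'e::euclidean_space) atlas \<Rightarrow> 'm metric \<Rightarrow> 'm conn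
      \<Rightarrow> 'm \<Rightarrow> 'm tvec \<Rightarrow> 'm tvec \<Rightarrow> real" where
  "Ric A g nabla x u v = (\<Sum>e\<in>frame_at A g x. g x (curvature A nabla x u e e) v)"

definition Ric_sharp ::
    "('m::topological_space, 'e::euclidean_space) atlas \<Rightarrow> 'm metric \<Rightarrow> 'm conn
      \<Rightarrow> 'm \<Rightarrow> 'm tvec \<Rightarrow> 'm tvec" where
  "Ric_sharp A g nabla x u = sharp A g x (Ric A g nabla x u)"

definition scal ::
    "('m::topological_space, 'e::euclidean_space) atlas \<Rightarrow> 'm metric \<Rightarrow> 'm conn \<Rightarrow> 'm \<Rightarrow> real" where
  "scal A g nabla x = (\<Sum>e\<in>frame_at A g x. Ric A g nabla x e e)"

definition schouten ::
    "('m::topological_space, 'e::euclidean_space) atlas \<Rightarrow> 'm metric \<Rightarrow> 'm conn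
      \<Rightarrow> 'm \<Rightarrow> 'm tvec \<Rightarrow> 'm tvec \<Rightarrow> real" where
  "schouten A g nabla x u v =
     (Ric A g nabla x u v - scal A g nabla x / (2 * (real DIM('e) - 1)) * g x u v)
       / (real DIM('e) - 2)"

text \<open>The totally trace-free part of the curvature (in dimension at least 3): the Kulkarni-Nomizu
  product of \<open>g\<close> and the Schouten tensor, which carries all the traces, is subtracted.  The sign
  is that of \<open>R(X,Y)Z = k (g(Y,Z) X - g(X,Z) Y)\<close> for constant sectional curvature \<open>k\<close>.\<close>

definition weyl_tensor ::
    "('m::topological_space, 'e::euclidean_space) atlas \<Rightarrow> 'm metric \<Rightarrow> 'm conn
      \<Rightarrow> 'm \<Rightarrow> 'm tvec \<Rightarrow> 'm tvec \<Rightarrow> 'm tvec \<Rightarrow> 'm tvec" where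
  "weyl_tensor A g nabla x u v w =
     (let P = schouten A g nabla x in
        curvature A nabla x u v w
          - (P v w *\<^sub>R u - P u w *\<^sub>R v
             + g x v w *\<^sub>R sharp A g x (P u) - g x u w *\<^sub>R sharp A g x (P v)))"

definition K_W ::
    "('m::topological_space, 'e::euclidean_space) atlas \<Rightarrow> 'm metric \<Rightarrow> 'm conn
      \<Rightarrow> ('m \<Rightarrow> 'm tvec \<Rightarrow> 'm tvec) \<Rightarrow> 'm \<Rightarrow> 'm tvec \<Rightarrow> 'm tvec" where
  "K_W A g nabla S x u = (\<Sum>e\<in>frame_at A g x. weyl_tensor A g nabla x u e (S x e))"

definition cov_form ::
    "('m::topological_space, 'e::euclidean_space) atlas \<Rightarrow> 'm conn \<Rightarrow> 'm oneform
      \<Rightarrow> 'm \<Rightarrow> 'm tvec \<Rightarrow> 'm tvec \<Rightarrow> real" where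
  "cov_form A nabla \<theta> x u v =
     (let Y = extend A x v in u (\<lambda>y. \<theta> y (Y y)) - \<theta> x (nabla x u Y))"

definition Theta ::
    "('m::topological_space, 'e::euclidean_space) atlas \<Rightarrow> 'm metric \<Rightarrow> 'm conn \<Rightarrow> 'm oneform
      \<Rightarrow> 'm \<Rightarrow> 'm tvec \<Rightarrow> 'm tvec" where
  "Theta A g nabla \<theta> x u = sharp A g x (cov_form A nabla \<theta> x u)"

definition transp ::
    "('m::topological_space, 'e::euclidean_space) atlas \<Rightarrow> 'm metric
      \<Rightarrow> ('m \<Rightarrow> 'm tvec \<Rightarrow> 'm tvec) \<Rightarrow> 'm \<Rightarrow> 'm tvec \<Rightarrow> 'm tvec" where
  "transp A g B x u = sharp A g x (\<lambda>v. g x u (B x v))"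

definition Theta_sym ::
    "('m::topological_space, 'e::euclidean_space) atlas \<Rightarrow> 'm metric \<Rightarrow> 'm conn \<Rightarrow> 'm oneform
      \<Rightarrow> 'm \<Rightarrow> 'm tvec \<Rightarrow> 'm tvec" where
  "Theta_sym A g nabla \<theta> x u =
     (1 / 2) *\<^sub>R (Theta A g nabla \<theta> x u + transp A g (Theta A g nabla \<theta>) x u)"

definition ext_deriv ::
    "('m::topological_space, 'e::euclidean_space) atlas \<Rightarrow> 'm oneform
      \<Rightarrow> 'm \<Rightarrow> 'm tvec \<Rightarrow> 'm tvec \<Rightarrow> real" where
  "ext_deriv A \<theta> x u v =
     (let X = extend A x u; Y = extend A x v in
        X x (\<lambda>y. \<theta> y (Y y)) - Y x (\<lambda>y. \<theta> y (X y)) - \<theta> x (lie_bracket A X Y x))"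

definition ext_deriv_sharp ::
    "('m::topological_space, 'e::euclidean_space) atlas \<Rightarrow> 'm metric \<Rightarrow> 'm oneform
      \<Rightarrow> 'm \<Rightarrow> 'm tvec \<Rightarrow> 'm tvec" where
  "ext_deriv_sharp A g \<theta> x u = sharp A g x (ext_deriv A \<theta> x u)"

definition commutator ::
    "('m \<Rightarrow> 'm tvec \<Rightarrow> 'm tvec) \<Rightarrow> ('m \<Rightarrow> 'm tvec \<Rightarrow> 'm tvec) \<Rightarrow> 'm \<Rightarrow> 'm tvec \<Rightarrow> 'm tvec" where
  "commutator B C x u = B x (C x u) - C x (B x u)"

definition wedge :: "'m metric \<Rightarrow> 'm \<Rightarrow> 'm tvec \<Rightarrow> 'm tvec \<Rightarrow> 'm tvec \<Rightarrow> 'm tvec" where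
  "wedge g x u v w = g x v w *\<^sub>R u - g x u w *\<^sub>R v"

end

theory Submission
  imports Defs
begin

text \<open>
Both identities are consequences of a single fact: the Weyl connection \<open>D\<close> preserves the orthogonal
splitting, so its curvature \<open>R\<^sup>D(X,Y)\<close> maps \<open>T1\<close> to \<open>T1\<close>. Expressed through the curvature \<open>R\<close> of
\<open>g\<close>, this says that for \<open>Z\<close> in \<open>T1\<close> and \<open>W\<close> in \<open>T2\<close>, and all \<open>X\<close> and \<open>Y\<close>,

\<open>g(R(X,Y)Z, W) = b(Y,Z) g(X,W) - b(X,Z) g(Y,W) + g(Y,Z) b(X,W) - g(X,Z) b(Y,W)\<close>

with \<open>b = \<nabla>\<theta> - \<theta> \<otimes> \<theta> + |\<theta>|\<^sup>2 g / 2\<close> (\<open>mixed_curvature\<close>). The rest is linear algebra at one point.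
The pair symmetry of \<open>R\<close> forces \<open>b\<close> to be symmetric on each of \<open>T1\<close> and \<open>T2\<close>, so \<open>d\<theta>\<close>, which is
twice the antisymmetric part of \<open>b\<close>, has only mixed components; commutators with \<open>S\<close> have only mixed
components as well. For \<open>i\<close> in \<open>T1\<close> and \<open>k\<close> in \<open>T2\<close>, tracing the equation over the two halves of an
adapted orthonormal frame gives \<open>(p - 1) b(i,k)\<close> and \<open>(q - 1) b(k,i)\<close> (\<open>partial_traces\<close>). The sum of
the two is \<open>Ric(i,k)\<close>; rewritten in terms of the symmetric and antisymmetric parts of \<open>b\<close>, it is the
second identity (\<open>ricci_commutator\<close>). The difference is the part of \<open>\<K>\<^sub>W\<close> that comes from \<open>R\<close>, and
subtracting the contribution \<open>(p - q) Ric(i,k) / (n - 2)\<close> of the Schouten tensor leaves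
\<open>2 (p - 1) (q - 1) / (n - 2)\<close> times \<open>b(i,k) - b(k,i)\<close>, which is the first identity
(\<open>weyl_commutator\<close>).

On the differential-geometric side, everything is arranged so that charts are used only for the
sums and products of smooth functions. Vectors are extended to fields by means of the frames of the
two distributions. The curvature is a tensor because \<open>g(R(X,Y)Z, W)\<close> depends pointwise on \<open>W\<close>, and
the symmetries, which hold for vector fields, carry this over to the other three arguments
(\<open>field_curvature_tensorial\<close>). The one-form \<open>\<theta>\<close> has a tensorial covariant derivative because \<open>D\<close>
and \<open>\<nabla>\<close> being smooth makes \<open>g(X,X) \<theta>\<^sup>\<sharp>\<close> smooth (\<open>cov_representation\<close>). The curvature equation
then comes from differentiating the second fundamental form
\<open>g(\<nabla>\<^sub>Y Z, W) = g(Y,Z) \<theta>(W) - g(Y,W) \<theta>(Z)\<close> of \<open>T1\<close>.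
\<close>

section \<open>Functions of class \<open>C\<^sup>k\<close> on open sets\<close>

lemma Ck_on_subset: "Ck_on k S f \<Longrightarrow> T \<subseteq> S \<Longrightarrow> Ck_on k T f"
  by (induction k arbitrary: f) (auto intro: continuous_on_subset)

text \<open>The derivative of order \<open>k + 1\<close> in \<open>Ck_on\<close> is taken at a point of the whole space, so it sees a
full neighbourhood: agreement on \<open>S\<close> is enough because \<open>S\<close> is open.\<close>

lemma Ck_on_cong:
  assumes "open S" "Ck_on k S f" "\<And>x. x \<in> S \<Longrightarrow> f x = h x"
  shows "Ck_on k S h"
  using assms(2,3)
proof (induction k arbitrary: f h)
  case 0
  then show ?case by (auto cong: continuous_on_cong)
next
  case (Suc k)
  have d: "(h has_derivative frechet_derivative f (at x)) (at x)" if "x \<in> S" for x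
    using Suc.prems that frechet_derivative_works
    by (metis Ck_on.simps(2) assms(1) has_derivative_transform_within_open)
  have "Ck_on k S (\<lambda>x. frechet_derivative h (at x) v)" for v
    by (rule Suc.IH[of "\<lambda>x. frechet_derivative f (at x) v"])
      (use Suc.prems(1) in \<open>auto simp: frechet_derivative_at[OF d, symmetric]\<close>)
  then show ?case
    using d by (auto simp: differentiable_def)
qed

text \<open>The product rule below multiplies a derivative by an undifferentiated factor, and its induction
step needs both at the same order \<open>k\<close>.\<close>

lemma Ck_on_SucD: "Ck_on (Suc k) S f \<Longrightarrow> Ck_on k S f"
proof (induction k arbitrary: f)
  case 0
  then show ?case
    by (auto simp: differentiable_imp_continuous_within continuous_on_eq_continuous_within
        differentiable_at_withinI)
qed (metis Ck_on.simps(2))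

lemma Ck_on_const: "Ck_on k S (\<lambda>x. c)"
  by (induction k arbitrary: c) (auto simp: frechet_derivative_const)

lemma Ck_on_add:
  assumes "open S" "Ck_on k S f" "Ck_on k S h"
  shows "Ck_on k S (\<lambda>x. f x + h x)"
  using assms(2,3)
proof (induction k arbitrary: f h)
  case 0
  then show ?case by (auto intro: continuous_on_add)
next
  case (Suc k)
  have d: "((\<lambda>x. f x + h x) has_derivative
      (\<lambda>v. frechet_derivative f (at x) v + frechet_derivative h (at x) v)) (at x)" if "x \<in> S" for x
    using Suc.prems that
    by (intro has_derivative_add) (simp_all add: frechet_derivative_works[THEN iffD1])
  have "Ck_on k S (\<lambda>x. frechet_derivative (\<lambda>x. f x + h x) (at x) v)" for v
    by (rule Ck_on_cong[OF assms(1) Suc.IH[of "\<lambda>x. frechet_derivative f (at x) v"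
          "\<lambda>x. frechet_derivative h (at x) v"]])
      (use Suc.prems in \<open>auto simp: frechet_derivative_at[OF d, symmetric]\<close>)
  then show ?case
    using d by (auto simp: differentiable_def)
qed

lemma Ck_on_mult:
  fixes f h :: "'a::real_normed_vector \<Rightarrow> 'b::real_normed_algebra"
  assumes "open S" "Ck_on k S f" "Ck_on k S h"
  shows "Ck_on k S (\<lambda>x. f x * h x)"
  using assms(2,3)
proof (induction k arbitrary: f h)
  case 0
  then show ?case by (auto intro: continuous_on_mult)
next
  case (Suc k)
  have d: "((\<lambda>x. f x * h x) has_derivative
      (\<lambda>v. f x * frechet_derivative h (at x) v + frechet_derivative f (at x) v * h x)) (at x)"
    if "x \<in> S" for x
    using Suc.prems that
    by (intro has_derivative_mult) (simp_all add: frechet_derivative_works[THEN iffD1])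
  have "Ck_on k S (\<lambda>x. frechet_derivative (\<lambda>x. f x * h x) (at x) v)" for v
  proof (rule Ck_on_cong[OF assms(1)])
    show "Ck_on k S (\<lambda>x. f x * frechet_derivative h (at x) v + frechet_derivative f (at x) v * h x)"
      using Suc.prems Suc.prems[THEN Ck_on_SucD]
      by (intro Ck_on_add[OF assms(1)] Suc.IH) auto
  qed (simp add: frechet_derivative_at[OF d, symmetric])
  then show ?case
    using d by (auto simp: differentiable_def)
qed

section \<open>Germs of functions, tangent vectors and vector fields\<close>

locale manifold =
  fixes A :: "('m::{t2_space, second_countable_topology}, 'e::euclidean_space) atlas"
  assumes atlas: "smooth_atlas A"
begin

abbreviation "smooth_at \<equiv> smooth_fun_at A"
abbreviation "field_at \<equiv> vfield_at A"
abbreviation "tangent \<equiv> tangent_space A"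

lemma open_chart_image:
  assumes "(V, \<phi>) \<in> A" "open U"
  shows "open (\<phi> ` (U \<inter> V))"
proof -
  have V: "open (\<phi> ` V)" "homeomorphism V (\<phi> ` V) \<phi> (inv_into V \<phi>)"
    using atlas assms(1) by (auto simp: smooth_atlas_def)
  have "openin (top_of_set V) (U \<inter> V)"
    using assms(2) by (metis openin_open_Int inf_commute)
  then have "openin (top_of_set (\<phi> ` V)) (\<phi> ` (U \<inter> V))"
    using V(2) homeomorphism_imp_open_map by blast
  then show ?thesis
    using V(1) openin_open_trans by blast
qed

lemma chart_inv:
  assumes "(V, \<phi>) \<in> A" "y \<in> V"
  shows "inv_into V \<phi> (\<phi> y) = y"
proof -
  have "homeomorphism V (\<phi> ` V) \<phi> (inv_into V \<phi>)"
    using atlas assms(1) by (auto simp: smooth_atlas_def)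
  then show ?thesis
    using assms(2) homeomorphism_apply1 by blast
qed

lemma smooth_fun_on_cong:
  assumes "smooth_fun_on A U f" "\<And>y. y \<in> U \<Longrightarrow> f y = h y"
  shows "smooth_fun_on A U h"
proof -
  have U: "open U"
    using assms(1) by (simp add: smooth_fun_on_def)
  have "Ck_on k (\<phi> ` (U \<inter> V)) (h \<circ> inv_into V \<phi>)" if V: "(V, \<phi>) \<in> A" for k V \<phi>
  proof (rule Ck_on_cong[OF open_chart_image[OF V U]])
    show "Ck_on k (\<phi> ` (U \<inter> V)) (f \<circ> inv_into V \<phi>)"
      using assms(1) V by (auto simp: smooth_fun_on_def smooth_on_def)
  qed (use V assms(2) in \<open>auto simp: chart_inv\<close>)
  then show ?thesis
    using U by (auto simp: smooth_fun_on_def smooth_on_def)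
qed

lemma smooth_fun_on_subset:
  assumes "smooth_fun_on A U f" "open W" "W \<subseteq> U"
  shows "smooth_fun_on A W f"
proof -
  have "Ck_on k (\<phi> ` (W \<inter> V)) (f \<circ> inv_into V \<phi>)" if V: "(V, \<phi>) \<in> A" for k V \<phi>
  proof (rule Ck_on_subset)
    show "Ck_on k (\<phi> ` (U \<inter> V)) (f \<circ> inv_into V \<phi>)"
      using assms(1) V by (auto simp: smooth_fun_on_def smooth_on_def)
  qed (use assms(3) in auto)
  then show ?thesis
    using assms(2) by (auto simp: smooth_fun_on_def smooth_on_def)
qed

lemma smooth_fun_on_const: "open U \<Longrightarrow> smooth_fun_on A U (\<lambda>y. c)"
  by (auto simp: smooth_fun_on_def smooth_on_def o_def Ck_on_const)

lemma smooth_fun_on_add: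
  assumes "smooth_fun_on A U f" "smooth_fun_on A U h"
  shows "smooth_fun_on A U (\<lambda>y. f y + h y)"
  using assms unfolding smooth_fun_on_def smooth_on_def o_def
  by (auto intro!: Ck_on_add open_chart_image)

lemma smooth_fun_on_mult:
  assumes "smooth_fun_on A U f" "smooth_fun_on A U h"
  shows "smooth_fun_on A U (\<lambda>y. f y * h y)"
  using assms unfolding smooth_fun_on_def smooth_on_def o_def
  by (auto intro!: Ck_on_mult open_chart_image)

lemma smooth_at_eventually: "smooth_at x f \<Longrightarrow> \<forall>\<^sub>F y in nhds x. smooth_at y f"
  unfolding smooth_fun_at_def eventually_nhds by (auto simp: smooth_fun_on_def)

lemma smooth_at_cong:
  assumes "smooth_at x f" "\<forall>\<^sub>F y in nhds x. f y = h y"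
  shows "smooth_at x h"
proof -
  obtain U where U: "x \<in> U" "smooth_fun_on A U f"
    using assms(1) smooth_fun_at_def by blast
  obtain W where W: "x \<in> W" "open W" "\<And>y. y \<in> W \<Longrightarrow> f y = h y"
    using assms(2) unfolding eventually_nhds by blast
  have "open U" using U by (simp add: smooth_fun_on_def)
  then have "smooth_fun_on A (U \<inter> W) h"
    by (intro smooth_fun_on_cong[OF smooth_fun_on_subset[OF U(2)]])
      (use W in auto)
  then show ?thesis
    using U W unfolding smooth_fun_at_def by blast
qed

lemma smooth_at_common:
  assumes "smooth_at x f" "smooth_at x h"
  obtains U where "x \<in> U" "open U" "smooth_fun_on A U f" "smooth_fun_on A U h"
proof -
  obtain U where U: "x \<in> U" "smooth_fun_on A U f"
    using assms(1) unfolding smooth_fun_at_def by blast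
  moreover obtain W where W: "x \<in> W" "smooth_fun_on A W h"
    using assms(2) unfolding smooth_fun_at_def by blast
  moreover have "open U" "open W" using U W by (auto simp: smooth_fun_on_def)
  ultimately show ?thesis
    by (intro that[of "U \<inter> W"] smooth_fun_on_subset[OF U(2)] smooth_fun_on_subset[OF W(2)]) auto
qed

lemma smooth_at_const: "smooth_at x (\<lambda>y. c)"
  using smooth_fun_on_const[OF open_UNIV] unfolding smooth_fun_at_def by blast

lemma smooth_at_add: "smooth_at x f \<Longrightarrow> smooth_at x h \<Longrightarrow> smooth_at x (\<lambda>y. f y + h y)"
  by (erule (1) smooth_at_common) (auto simp: smooth_fun_at_def dest: smooth_fun_on_add)

lemma smooth_at_mult: "smooth_at x f \<Longrightarrow> smooth_at x h \<Longrightarrow> smooth_at x (\<lambda>y. f y * h y)"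
  by (erule (1) smooth_at_common) (auto simp: smooth_fun_at_def dest: smooth_fun_on_mult)

lemma smooth_at_cmult: "smooth_at x f \<Longrightarrow> smooth_at x (\<lambda>y. c * f y)"
  by (intro smooth_at_mult smooth_at_const)

lemma smooth_at_diff: "smooth_at x f \<Longrightarrow> smooth_at x h \<Longrightarrow> smooth_at x (\<lambda>y. f y - h y)"
  using smooth_at_add[of x f "\<lambda>y. - 1 * h y"] smooth_at_cmult[of x h "-1"] by simp

lemma tangent_add: "v \<in> tangent x \<Longrightarrow> smooth_at x f \<Longrightarrow> smooth_at x h \<Longrightarrow>
    v (\<lambda>y. f y + h y) = v f + v h"
  and tangent_mult: "v \<in> tangent x \<Longrightarrow> smooth_at x f \<Longrightarrow> smooth_at x h \<Longrightarrow>
    v (\<lambda>y. f y * h y) = f x * v h + h x * v f"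
  and tangent_cmult: "v \<in> tangent x \<Longrightarrow> smooth_at x f \<Longrightarrow> v (\<lambda>y. c * f y) = c * v f"
  and tangent_nonsmooth: "v \<in> tangent x \<Longrightarrow> \<not> smooth_at x f \<Longrightarrow> v f = 0"
  unfolding tangent_space_def by blast+

lemma tangent_diff: "v \<in> tangent x \<Longrightarrow> smooth_at x f \<Longrightarrow> smooth_at x h \<Longrightarrow>
    v (\<lambda>y. f y - h y) = v f - v h"
  using tangent_add[of v x f "\<lambda>y. - 1 * h y"] tangent_cmult[of v x h "-1"] smooth_at_cmult[of x h "-1"]
  by simp

text \<open>A function that is smooth near \<open>x\<close> may be anything elsewhere, so the indicator function of the
complement of a neighbourhood of \<open>x\<close> is a cutoff.
Multiplying by it turns a Leibniz rule into locality, for tangent vectors and for connections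
alike.\<close>

lemma smooth_cutoff:
  assumes "\<forall>\<^sub>F y in nhds x. P y"
  obtains c :: "'m \<Rightarrow> real" where "smooth_at x c" "c x = 0" "\<And>y. \<not> P y \<Longrightarrow> c y = 1"
proof -
  obtain W where W: "x \<in> W" "open W" "\<And>y. y \<in> W \<Longrightarrow> P y"
    using assms unfolding eventually_nhds by blast
  show ?thesis
  proof (rule that[of "\<lambda>y. if y \<in> W then 0 else 1"])
    show "smooth_at x (\<lambda>y. if y \<in> W then 0 else 1)"
    proof (rule smooth_at_cong[OF smooth_at_const[of x 0]])
      show "\<forall>\<^sub>F y in nhds x. 0 = (if y \<in> W then 0 else 1 :: real)"
        using eventually_nhds_in_open[OF W(2,1)] by (rule eventually_mono) simp
    qed
  qed (use W in auto)
qed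

text \<open>With the cutoff \<open>c\<close>, the difference \<open>f - h\<close> equals \<open>c * (f - h)\<close>, a product of two functions
that vanish at \<open>x\<close>; the Leibniz rule makes every derivation kill it.\<close>

lemma tangent_cong:
  assumes "v \<in> tangent x" "\<forall>\<^sub>F y in nhds x. f y = h y"
  shows "v f = v h"
proof (cases "smooth_at x f")
  case True
  then have h: "smooth_at x h"
    using assms(2) smooth_at_cong by blast
  obtain c where c: "smooth_at x c" "c x = 0" "\<And>y. f y \<noteq> h y \<Longrightarrow> c y = 1"
    using smooth_cutoff[OF assms(2)] by blast
  have eq: "f x = h x"
    using assms(2) eventually_nhds_x_imp_x by blast
  have "(\<lambda>y. f y - h y) = (\<lambda>y. c y * (f y - h y))"
    using c(3) by fastforce
  then have "v (\<lambda>y. f y - h y) = 0"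
    using tangent_mult[OF assms(1) c(1) smooth_at_diff[OF True h]] c(2) eq by simp
  then show ?thesis
    using tangent_diff[OF assms(1) True h] by simp
next
  case False
  then have "\<not> smooth_at x h"
    using smooth_at_cong[of x h f] assms(2) by (auto simp: eq_commute)
  then show ?thesis
    using False tangent_nonsmooth[OF assms(1)] by simp
qed

lemma subspace_tangent: "subspace (tangent x)"
  unfolding subspace_def
proof (intro conjI ballI allI)
  show "0 \<in> tangent x" unfolding tangent_space_def by simp
next
  fix u v assume "u \<in> tangent x" "v \<in> tangent x"
  then show "u + v \<in> tangent x"
    unfolding tangent_space_def by (simp add: algebra_simps)
next
  fix a :: real and u assume "u \<in> tangent x"
  then show "a *\<^sub>R u \<in> tangent x"
    unfolding tangent_space_def by (simp add: algebra_simps scaleR_fun_def)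
qed

lemma field_at_tangent: "field_at x X \<Longrightarrow> X x \<in> tangent x"
  unfolding vfield_at_def vfield_on_def by blast

lemma field_at_eventually: "field_at x X \<Longrightarrow> \<forall>\<^sub>F y in nhds x. field_at y X"
  unfolding vfield_at_def eventually_nhds by (auto simp: vfield_on_def)

lemma vfield_on_subset: "vfield_on A U X \<Longrightarrow> open W \<Longrightarrow> W \<subseteq> U \<Longrightarrow> vfield_on A W X"
  unfolding vfield_on_def by blast

lemma vfield_on_cong:
  assumes "vfield_on A U X" "\<And>y. y \<in> U \<Longrightarrow> X y = Y y"
  shows "vfield_on A U Y"
  unfolding vfield_on_def
proof (intro conjI ballI allI impI)
  fix V f assume V: "V \<subseteq> U \<and> smooth_fun_on A V f"
  then have "smooth_fun_on A V (\<lambda>y. X y f)"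
    using assms(1) by (simp add: vfield_on_def)
  then show "smooth_fun_on A V (\<lambda>y. Y y f)"
    by (rule smooth_fun_on_cong) (use V assms(2) in auto)
qed (use assms in \<open>auto simp: vfield_on_def\<close>)

lemma field_at_common:
  assumes "field_at x X" "field_at x Y"
  obtains U where "x \<in> U" "open U" "vfield_on A U X" "vfield_on A U Y"
proof -
  obtain U where U: "x \<in> U" "vfield_on A U X"
    using assms(1) unfolding vfield_at_def by blast
  moreover obtain W where W: "x \<in> W" "vfield_on A W Y"
    using assms(2) unfolding vfield_at_def by blast
  moreover have "open U" "open W" using U W by (auto simp: vfield_on_def)
  ultimately show ?thesis
    by (intro that[of "U \<inter> W"] vfield_on_subset[OF U(2)] vfield_on_subset[OF W(2)]) auto
qed

lemma field_at_cong:
  assumes "field_at x X" "\<forall>\<^sub>F y in nhds x. X y = Y y"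
  shows "field_at x Y"
proof -
  obtain U where U: "x \<in> U" "vfield_on A U X"
    using assms(1) vfield_at_def by blast
  obtain W where W: "x \<in> W" "open W" "\<And>y. y \<in> W \<Longrightarrow> X y = Y y"
    using assms(2) unfolding eventually_nhds by blast
  have "open U" using U by (simp add: vfield_on_def)
  then have "vfield_on A (U \<inter> W) Y"
    by (intro vfield_on_cong[OF vfield_on_subset[OF U(2)]])
      (use W in auto)
  then show ?thesis
    using U W unfolding vfield_at_def by blast
qed

lemma vfield_on_zero: "open U \<Longrightarrow> vfield_on A U (\<lambda>y. 0)"
  unfolding vfield_on_def
  by (auto simp: subspace_0[OF subspace_tangent, unfolded zero_fun_def] zero_fun_def smooth_fun_on_def smooth_on_def o_def Ck_on_const)

lemma vfield_on_add:
  assumes "vfield_on A U X" "vfield_on A U Y"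
  shows "vfield_on A U (\<lambda>y. X y + Y y)"
  using assms unfolding vfield_on_def
  by (auto intro!: subspace_add[OF subspace_tangent] smooth_fun_on_add)

lemma vfield_on_scale:
  assumes "smooth_fun_on A U a" "vfield_on A U X"
  shows "vfield_on A U (\<lambda>y. a y *\<^sub>R X y)"
  unfolding vfield_on_def
proof (intro conjI ballI allI impI)
  show "a y *\<^sub>R X y \<in> tangent y" if "y \<in> U" for y
    using that assms(2) by (auto simp: vfield_on_def intro: subspace_scale[OF subspace_tangent])
next
  fix V f assume V: "V \<subseteq> U \<and> smooth_fun_on A V f"
  then have "smooth_fun_on A V (\<lambda>y. X y f)" "open V"
    using assms(2) by (auto simp: vfield_on_def smooth_fun_on_def)
  then show "smooth_fun_on A V (\<lambda>y. (a y *\<^sub>R X y) f)"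
    using V smooth_fun_on_mult[OF smooth_fun_on_subset[OF assms(1)]] by (simp add: scaleR_fun_def)
qed (use assms(2) in \<open>simp add: vfield_on_def\<close>)

lemma field_at_add: "field_at x X \<Longrightarrow> field_at x Y \<Longrightarrow> field_at x (\<lambda>y. X y + Y y)"
  by (erule (1) field_at_common) (auto simp: vfield_at_def dest: vfield_on_add)

lemma field_at_scale:
  assumes "smooth_at x a" "field_at x X"
  shows "field_at x (\<lambda>y. a y *\<^sub>R X y)"
proof -
  obtain U where U: "x \<in> U" "smooth_fun_on A U a"
    using assms(1) unfolding smooth_fun_at_def by blast
  moreover obtain W where W: "x \<in> W" "vfield_on A W X"
    using assms(2) unfolding vfield_at_def by blast
  moreover have "open U" "open W" using U W by (auto simp: vfield_on_def smooth_fun_on_def)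
  ultimately have "vfield_on A (U \<inter> W) (\<lambda>y. a y *\<^sub>R X y)"
    by (intro vfield_on_scale smooth_fun_on_subset[OF U(2)] vfield_on_subset[OF W(2)]) auto
  then show ?thesis
    using \<open>x \<in> U\<close> \<open>x \<in> W\<close> unfolding vfield_at_def by blast
qed

lemma field_at_cscale: "field_at x X \<Longrightarrow> field_at x (\<lambda>y. c *\<^sub>R X y)"
  by (rule field_at_scale[OF smooth_at_const])

lemma field_at_diff: "field_at x X \<Longrightarrow> field_at x Y \<Longrightarrow> field_at x (\<lambda>y. X y - Y y)"
  using field_at_add[of x X "\<lambda>y. (-1) *\<^sub>R Y y"] field_at_cscale[of x Y "-1"] by simp

lemma smooth_at_deriv:
  assumes "field_at x X" "smooth_at x f"
  shows "smooth_at x (\<lambda>y. X y f)"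
proof -
  obtain U where U: "x \<in> U" "smooth_fun_on A U f"
    using assms(2) unfolding smooth_fun_at_def by blast
  moreover obtain W where W: "x \<in> W" "vfield_on A W X"
    using assms(1) unfolding vfield_at_def by blast
  moreover have "open U" "open W" using U W by (auto simp: vfield_on_def smooth_fun_on_def)
  ultimately have "smooth_fun_on A (U \<inter> W) f"
    by (intro smooth_fun_on_subset[OF U(2)]) auto
  then have "smooth_fun_on A (U \<inter> W) (\<lambda>y. X y f)"
    using W unfolding vfield_on_def by simp
  then show ?thesis
    using U W unfolding smooth_fun_at_def by blast
qed

end

section \<open>Lie brackets and connections\<close>

context manifold begin

lemma lie_bracket_smooth:
  "smooth_at x f \<Longrightarrow> lie_bracket A X Y x f = X x (\<lambda>y. Y y f) - Y x (\<lambda>y. X y f)"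
  by (simp add: lie_bracket_def)

lemma deriv_add_eventually:
  assumes "field_at x X" "smooth_at x f" "smooth_at x h"
  shows "\<forall>\<^sub>F y in nhds x. X y (\<lambda>z. f z + h z) = X y f + X y h"
  using field_at_eventually[OF assms(1)] smooth_at_eventually[OF assms(2)]
    smooth_at_eventually[OF assms(3)]
  by eventually_elim (rule tangent_add[OF field_at_tangent])

lemma deriv_mult_eventually:
  assumes "field_at x X" "smooth_at x f" "smooth_at x h"
  shows "\<forall>\<^sub>F y in nhds x. X y (\<lambda>z. f z * h z) = f y * X y h + h y * X y f"
  using field_at_eventually[OF assms(1)] smooth_at_eventually[OF assms(2)]
    smooth_at_eventually[OF assms(3)]
  by eventually_elim (rule tangent_mult[OF field_at_tangent])

lemma deriv_cmult_eventually:
  assumes "field_at x X" "smooth_at x f"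
  shows "\<forall>\<^sub>F y in nhds x. X y (\<lambda>z. c * f z) = c * X y f"
  using field_at_eventually[OF assms(1)] smooth_at_eventually[OF assms(2)]
  by eventually_elim (rule tangent_cmult[OF field_at_tangent])

text \<open>The terms with two first derivatives, such as \<open>(X f) (Y h)\<close>, occur in both iterated derivatives of
a product and cancel. The Leibniz rule for the inner field holds only near \<open>x\<close>, hence the passage
through germs.\<close>

lemma lie_bracket_tangent:
  assumes X: "field_at x X" and Y: "field_at x Y"
  shows "lie_bracket A X Y x \<in> tangent x"
proof -
  note T = field_at_tangent[OF X] field_at_tangent[OF Y]
  have add: "lie_bracket A X Y x (\<lambda>y. f y + h y) = lie_bracket A X Y x f + lie_bracket A X Y x h"
    if f: "smooth_at x f" and h: "smooth_at x h" for f h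
  proof -
    have "X x (\<lambda>y. Y y (\<lambda>z. f z + h z)) = X x (\<lambda>y. Y y f) + X x (\<lambda>y. Y y h)"
      unfolding tangent_cong[OF T(1) deriv_add_eventually[OF Y f h]]
      by (rule tangent_add[OF T(1) smooth_at_deriv[OF Y f] smooth_at_deriv[OF Y h]])
    moreover have "Y x (\<lambda>y. X y (\<lambda>z. f z + h z)) = Y x (\<lambda>y. X y f) + Y x (\<lambda>y. X y h)"
      unfolding tangent_cong[OF T(2) deriv_add_eventually[OF X f h]]
      by (rule tangent_add[OF T(2) smooth_at_deriv[OF X f] smooth_at_deriv[OF X h]])
    ultimately show ?thesis
      by (simp add: lie_bracket_smooth f h smooth_at_add)
  qed
  have cmult: "lie_bracket A X Y x (\<lambda>y. c * f y) = c * lie_bracket A X Y x f"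
    if f: "smooth_at x f" for c f
  proof -
    have "X x (\<lambda>y. Y y (\<lambda>z. c * f z)) = c * X x (\<lambda>y. Y y f)"
      unfolding tangent_cong[OF T(1) deriv_cmult_eventually[OF Y f]]
      by (rule tangent_cmult[OF T(1) smooth_at_deriv[OF Y f]])
    moreover have "Y x (\<lambda>y. X y (\<lambda>z. c * f z)) = c * Y x (\<lambda>y. X y f)"
      unfolding tangent_cong[OF T(2) deriv_cmult_eventually[OF X f]]
      by (rule tangent_cmult[OF T(2) smooth_at_deriv[OF X f]])
    ultimately show ?thesis
      by (simp add: lie_bracket_smooth f smooth_at_cmult algebra_simps)
  qed
  have mult: "lie_bracket A X Y x (\<lambda>y. f y * h y)
      = f x * lie_bracket A X Y x h + h x * lie_bracket A X Y x f"
    if f: "smooth_at x f" and h: "smooth_at x h" for f h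
  proof -
    note s = smooth_at_deriv[OF X f] smooth_at_deriv[OF X h]
      smooth_at_deriv[OF Y f] smooth_at_deriv[OF Y h]
    have "X x (\<lambda>y. Y y (\<lambda>z. f z * h z))
        = f x * X x (\<lambda>y. Y y h) + Y x h * X x f + (h x * X x (\<lambda>y. Y y f) + Y x f * X x h)"
      unfolding tangent_cong[OF T(1) deriv_mult_eventually[OF Y f h]]
      by (subst tangent_add[OF T(1)])
        (simp_all add: smooth_at_mult f h s tangent_mult[OF T(1)])
    moreover have "Y x (\<lambda>y. X y (\<lambda>z. f z * h z))
        = f x * Y x (\<lambda>y. X y h) + X x h * Y x f + (h x * Y x (\<lambda>y. X y f) + X x f * Y x h)"
      unfolding tangent_cong[OF T(2) deriv_mult_eventually[OF X f h]]
      by (subst tangent_add[OF T(2)])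
        (simp_all add: smooth_at_mult f h s tangent_mult[OF T(2)])
    ultimately show ?thesis
      by (simp add: lie_bracket_smooth f h smooth_at_mult algebra_simps)
  qed
  show ?thesis
    unfolding tangent_space_def using add mult cmult by (auto simp: lie_bracket_def)
qed

lemma field_at_lie_bracket:
  assumes "field_at x X" "field_at x Y"
  shows "field_at x (lie_bracket A X Y)"
proof -
  obtain U where U: "x \<in> U" "open U" "vfield_on A U X" "vfield_on A U Y"
    using field_at_common[OF assms] .
  have "vfield_on A U (lie_bracket A X Y)"
    unfolding vfield_on_def
  proof (intro conjI ballI allI impI)
    fix y assume "y \<in> U"
    then show "lie_bracket A X Y y \<in> tangent y"
      using U by (intro lie_bracket_tangent) (auto simp: vfield_at_def)
  next
    fix V f assume V: "V \<subseteq> U \<and> smooth_fun_on A V f"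
    have Yf: "smooth_fun_on A V (\<lambda>y. Y y f)" and Xf: "smooth_fun_on A V (\<lambda>y. X y f)"
      using U V by (auto simp: vfield_on_def)
    have "smooth_fun_on A V (\<lambda>y. X y (\<lambda>y. Y y f))" "smooth_fun_on A V (\<lambda>y. Y y (\<lambda>y. X y f))"
      using U(3,4) Yf Xf V by (auto simp: vfield_on_def)
    then have "smooth_fun_on A V (\<lambda>y. X y (\<lambda>y. Y y f) + (- 1) * Y y (\<lambda>y. X y f))"
      using V by (intro smooth_fun_on_add smooth_fun_on_mult smooth_fun_on_const)
        (auto simp: smooth_fun_on_def)
    then show "smooth_fun_on A V (\<lambda>y. lie_bracket A X Y y f)"
      by (rule smooth_fun_on_cong) (use V in \<open>auto simp: lie_bracket_def smooth_fun_at_def\<close>)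
  qed (use U in auto)
  then show ?thesis
    using U(1) vfield_at_def by blast
qed

lemma lie_bracket_skew: "lie_bracket A X Y x = - lie_bracket A Y X x"
  by (auto simp: lie_bracket_def fun_eq_iff)

lemma lie_bracket_jacobi:
  assumes X: "field_at x X" and Y: "field_at x Y" and Z: "field_at x Z"
  shows "lie_bracket A X (lie_bracket A Y Z) x + lie_bracket A Y (lie_bracket A Z X) x
    + lie_bracket A Z (lie_bracket A X Y) x = 0"
proof (rule ext)
  fix f
  show "(lie_bracket A X (lie_bracket A Y Z) x + lie_bracket A Y (lie_bracket A Z X) x
      + lie_bracket A Z (lie_bracket A X Y) x) f = (0 :: 'm tvec) f"
  proof (cases "smooth_at x f")
    case f: True
    have inner: "P x (\<lambda>y. lie_bracket A Q R y f)
        = P x (\<lambda>y. Q y (\<lambda>z. R z f)) - P x (\<lambda>y. R y (\<lambda>z. Q z f))"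
      if P: "field_at x P" and Q: "field_at x Q" and R: "field_at x R" for P Q R
    proof -
      have "P x (\<lambda>y. lie_bracket A Q R y f)
          = P x (\<lambda>y. Q y (\<lambda>z. R z f) - R y (\<lambda>z. Q z f))"
        using smooth_at_eventually[OF f]
        by (intro tangent_cong[OF field_at_tangent[OF P]]) (auto elim!: eventually_mono simp: lie_bracket_def)
      then show ?thesis
        using tangent_diff[OF field_at_tangent[OF P] smooth_at_deriv[OF Q smooth_at_deriv[OF R f]]
            smooth_at_deriv[OF R smooth_at_deriv[OF Q f]]] by simp
    qed
    show ?thesis
      by (simp add: lie_bracket_smooth[OF f] inner[OF X Y Z] inner[OF Y Z X] inner[OF Z X Y]
          lie_bracket_smooth[OF smooth_at_deriv[OF X f]] lie_bracket_smooth[OF smooth_at_deriv[OF Y f]]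
          lie_bracket_smooth[OF smooth_at_deriv[OF Z f]])
  qed (simp add: lie_bracket_def)
qed

lemma connection_tangent: "connection A D \<Longrightarrow> field_at x Y \<Longrightarrow> u \<in> tangent x \<Longrightarrow> D x u Y \<in> tangent x"
  and connection_linear: "connection A D \<Longrightarrow> field_at x Y \<Longrightarrow> u \<in> tangent x \<Longrightarrow> v \<in> tangent x \<Longrightarrow>
    D x (a *\<^sub>R u + v) Y = a *\<^sub>R D x u Y + D x v Y"
  and connection_add: "connection A D \<Longrightarrow> field_at x Y \<Longrightarrow> field_at x Z \<Longrightarrow> u \<in> tangent x \<Longrightarrow>
    D x u (\<lambda>y. Y y + Z y) = D x u Y + D x u Z"
  and connection_leibniz: "connection A D \<Longrightarrow> field_at x Y \<Longrightarrow> u \<in> tangent x \<Longrightarrow> smooth_at x f \<Longrightarrow>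
    D x u (\<lambda>y. f y *\<^sub>R Y y) = u f *\<^sub>R Y x + f x *\<^sub>R D x u Y"
  unfolding connection_def by blast+

lemma connection_diff_dir:
  assumes "connection A D" "field_at x Y" "u \<in> tangent x" "v \<in> tangent x"
  shows "D x (u - v) Y = D x u Y - D x v Y"
  using connection_linear[OF assms(1,2,4,3), of "-1"] by simp

lemma tangent_const: "v \<in> tangent x \<Longrightarrow> v (\<lambda>y. c) = 0"
  using tangent_cmult[OF _ smooth_at_const, of v x c 1] tangent_mult[OF _ smooth_at_const smooth_at_const, of v x 1 1]
  by simp

lemma connection_diff:
  assumes "connection A D" "field_at x Y" "field_at x Z" "u \<in> tangent x"
  shows "D x u (\<lambda>y. Y y - Z y) = D x u Y - D x u Z"
  using connection_add[OF assms(1,2) field_at_cscale[OF assms(3), of "-1"] assms(4)]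
    connection_leibniz[OF assms(1,3,4) smooth_at_const, of "-1"] tangent_const[OF assms(4)]
  by simp

text \<open>The same cutoff argument as for tangent vectors: \<open>Y - Z = c (Y - Z)\<close>, where \<open>c\<close> and \<open>Y - Z\<close> both
vanish at \<open>x\<close>.\<close>

lemma connection_cong:
  assumes D: "connection A D" and Y: "field_at x Y" and u: "u \<in> tangent x"
    and eq: "\<forall>\<^sub>F y in nhds x. Y y = Z y"
  shows "D x u Y = D x u Z"
proof -
  have Z: "field_at x Z"
    using field_at_cong[OF Y eq] .
  obtain c where c: "smooth_at x c" "c x = 0" "\<And>y. Y y \<noteq> Z y \<Longrightarrow> c y = 1"
    using smooth_cutoff[OF eq] by blast
  have "Y y - Z y = c y *\<^sub>R (Y y - Z y)" for y
    using c(3)[of y] by (cases "Y y = Z y") simp_all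
  then have "(\<lambda>y. Y y - Z y) = (\<lambda>y. c y *\<^sub>R (Y y - Z y))"
    by (rule ext)
  moreover have "Y x = Z x"
    using eq eventually_nhds_x_imp_x by blast
  ultimately have "D x u (\<lambda>y. Y y - Z y) = 0"
    using connection_leibniz[OF D field_at_diff[OF Y Z] u c(1)] c(2) by simp
  then show ?thesis
    using connection_diff[OF D Y Z u] by simp
qed

lemma field_at_connection:
  assumes "connection A D" "field_at x X" "field_at x Y"
  shows "field_at x (\<lambda>y. D y (X y) Y)"
proof -
  obtain U where "x \<in> U" "vfield_on A U X" "vfield_on A U Y"
    using field_at_common[OF assms(2,3)] .
  then have "vfield_on A U (\<lambda>y. D y (X y) Y)"
    using assms(1) by (simp add: connection_def)
  then show ?thesis
    using \<open>x \<in> U\<close> unfolding vfield_at_def by blast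
qed

end

locale riemannian_manifold = manifold A
  for A :: "('m::{t2_space, second_countable_topology}, 'e::euclidean_space) atlas" +
  fixes g :: "'m metric" and nabla :: "'m conn"
  assumes metric: "riemannian_metric A g" and lc: "levi_civita A g nabla"
begin

lemma g_linear1: "u \<in> tangent x \<Longrightarrow> v \<in> tangent x \<Longrightarrow> w \<in> tangent x \<Longrightarrow>
    g x (a *\<^sub>R u + v) w = a * g x u w + g x v w"
  and g_commute: "u \<in> tangent x \<Longrightarrow> v \<in> tangent x \<Longrightarrow> g x u v = g x v u"
  and g_pos: "u \<in> tangent x \<Longrightarrow> u \<noteq> 0 \<Longrightarrow> g x u u > 0"
  using metric unfolding riemannian_metric_def by blast+

lemma smooth_at_metric:
  assumes "field_at x X" "field_at x Y"
  shows "smooth_at x (\<lambda>y. g y (X y) (Y y))"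
proof -
  obtain U where "x \<in> U" "vfield_on A U X" "vfield_on A U Y"
    using field_at_common[OF assms] .
  then have "smooth_fun_on A U (\<lambda>y. g y (X y) (Y y))"
    using metric by (simp add: riemannian_metric_def)
  then show ?thesis
    using \<open>x \<in> U\<close> unfolding smooth_fun_at_def by blast
qed

lemma nabla_connection: "connection A nabla"
  using lc by (simp add: levi_civita_def)

lemma torsion_free: "field_at x X \<Longrightarrow> field_at x Y \<Longrightarrow>
    nabla x (X x) Y - nabla x (Y x) X = lie_bracket A X Y x"
  and metric_compatible: "u \<in> tangent x \<Longrightarrow> field_at x Y \<Longrightarrow> field_at x Z \<Longrightarrow>
    u (\<lambda>y. g y (Y y) (Z y)) = g x (nabla x u Y) (Z x) + g x (Y x) (nabla x u Z)"
  using lc unfolding levi_civita_def by blast+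

end

section \<open>Linear and bilinear forms on a Euclidean subspace\<close>

text \<open>Linearity relative to a subspace: a tangent space is a set inside the type of all functionals, and
forms such as a metric are unconstrained outside it.\<close>

definition linear_form_on :: "'v::real_vector set \<Rightarrow> ('v \<Rightarrow> real) \<Rightarrow> bool" where
  "linear_form_on V f \<longleftrightarrow> (\<forall>u\<in>V. \<forall>v\<in>V. \<forall>a. f (a *\<^sub>R u + v) = a * f u + f v)"

definition bilinear_form_on :: "'v::real_vector set \<Rightarrow> ('v \<Rightarrow> 'v \<Rightarrow> real) \<Rightarrow> bool" where
  "bilinear_form_on V F \<longleftrightarrow> (\<forall>w\<in>V. linear_form_on V (F w) \<and> linear_form_on V (\<lambda>u. F u w))"

lemma linear_form_onI:
  "(\<And>u v a. u \<in> V \<Longrightarrow> v \<in> V \<Longrightarrow> f (a *\<^sub>R u + v) = a * f u + f v) \<Longrightarrow> linear_form_on V f"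
  by (simp add: linear_form_on_def)

lemma linear_form_onD:
  "linear_form_on V f \<Longrightarrow> u \<in> V \<Longrightarrow> v \<in> V \<Longrightarrow> f (a *\<^sub>R u + v) = a * f u + f v"
  by (simp add: linear_form_on_def)

lemma bilinear_form_onD:
  assumes "bilinear_form_on V F" "w \<in> V"
  shows "linear_form_on V (F w)" "linear_form_on V (\<lambda>u. F u w)"
  using assms by (simp_all add: bilinear_form_on_def)

lemma linear_form_on_add_diff:
  assumes "linear_form_on V f" "linear_form_on V h"
  shows "linear_form_on V (\<lambda>u. f u + h u)" "linear_form_on V (\<lambda>u. f u - h u)"
  using assms by (auto simp: linear_form_on_def algebra_simps)

lemma linear_form_on_times:
  assumes "linear_form_on V f"
  shows "linear_form_on V (\<lambda>u. c * f u)" "linear_form_on V (\<lambda>u. f u * c)"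
  using assms by (auto simp: linear_form_on_def algebra_simps)

lemmas linear_form_on_arith = linear_form_on_add_diff linear_form_on_times

lemma linear_form_on_sum:
  assumes "\<And>e. e \<in> E \<Longrightarrow> linear_form_on V (f e)"
  shows "linear_form_on V (\<lambda>u. \<Sum>e\<in>E. f e u)"
  using assms by (auto simp: linear_form_on_def sum.distrib sum_distrib_left)

lemma
  assumes V: "subspace V" and f: "linear_form_on V f" and u: "u \<in> V"
  shows linear_form_zero: "f 0 = 0"
    and linear_form_scale: "f (a *\<^sub>R u) = a * f u"
    and linear_form_minus: "f (- u) = - f u"
proof -
  show 0: "f 0 = 0"
    using linear_form_onD[OF f subspace_0[OF V] subspace_0[OF V], of 1] by simp
  show s: "f (a *\<^sub>R u) = a * f u" for a
    using linear_form_onD[OF f u subspace_0[OF V]] 0 by simp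
  show "f (- u) = - f u"
    using s[of "-1"] by simp
qed

lemma linear_form_add: "linear_form_on V f \<Longrightarrow> u \<in> V \<Longrightarrow> v \<in> V \<Longrightarrow> f (u + v) = f u + f v"
  using linear_form_onD[of V f u v 1] by simp

lemma linear_form_diff: "linear_form_on V f \<Longrightarrow> u \<in> V \<Longrightarrow> v \<in> V \<Longrightarrow> f (u - v) = f u - f v"
  using linear_form_onD[of V f v u "-1"] by simp

lemma linear_form_lincomb:
  assumes V: "subspace V" and f: "linear_form_on V f" and B: "finite B" "B \<subseteq> V"
  shows "f (\<Sum>b\<in>B. c b *\<^sub>R b) = (\<Sum>b\<in>B. c b * f b)"
  using B
proof (induction B rule: finite_induct)
  case empty
  then show ?case using linear_form_zero[OF V f subspace_0[OF V]] by simp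
next
  case (insert b B)
  have "(\<Sum>b\<in>B. c b *\<^sub>R b) \<in> V"
    using insert.prems by (intro subspace_sum[OF V] subspace_scale[OF V]) auto
  then show ?case
    using insert linear_form_onD[OF f] by simp
qed

locale inner_subspace =
  fixes V :: "'v::real_vector set" and ip :: "'v \<Rightarrow> 'v \<Rightarrow> real"
  assumes subspace_V: "subspace V"
    and ip_linear: "u \<in> V \<Longrightarrow> v \<in> V \<Longrightarrow> w \<in> V \<Longrightarrow> ip (a *\<^sub>R u + v) w = a * ip u w + ip v w"
    and ip_commute: "u \<in> V \<Longrightarrow> v \<in> V \<Longrightarrow> ip u v = ip v u"
    and ip_pos: "u \<in> V \<Longrightarrow> u \<noteq> 0 \<Longrightarrow> ip u u > 0"
begin

lemmas V_closed = subspace_0[OF subspace_V] subspace_add[OF subspace_V] subspace_diff[OF subspace_V]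
  subspace_scale[OF subspace_V] subspace_neg[OF subspace_V] subspace_sum[OF subspace_V]

lemma ip_bilinear: "bilinear_form_on V ip"
  unfolding bilinear_form_on_def linear_form_on_def
  using ip_linear ip_commute V_closed by simp

lemmas ip_linear_right = bilinear_form_onD(1)[OF ip_bilinear]
  and ip_linear_left = bilinear_form_onD(2)[OF ip_bilinear]

lemma ip_add_diff:
  assumes "w \<in> V" "u \<in> V" "v \<in> V"
  shows "ip (u + v) w = ip u w + ip v w" "ip w (u + v) = ip w u + ip w v"
    "ip (u - v) w = ip u w - ip v w" "ip w (u - v) = ip w u - ip w v"
  using linear_form_add[OF ip_linear_left[OF assms(1)] assms(2,3)]
    linear_form_add[OF ip_linear_right[OF assms(1)] assms(2,3)]
    linear_form_diff[OF ip_linear_left[OF assms(1)] assms(2,3)]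
    linear_form_diff[OF ip_linear_right[OF assms(1)] assms(2,3)]
  by simp_all

lemma ip_scale_minus:
  assumes "w \<in> V" "u \<in> V"
  shows "ip (a *\<^sub>R u) w = a * ip u w" "ip w (a *\<^sub>R u) = a * ip w u"
    "ip (- u) w = - ip u w" "ip w (- u) = - ip w u"
  using linear_form_scale[OF subspace_V ip_linear_left[OF assms(1)] assms(2)]
    linear_form_scale[OF subspace_V ip_linear_right[OF assms(1)] assms(2)]
    linear_form_minus[OF subspace_V ip_linear_left[OF assms(1)] assms(2)]
    linear_form_minus[OF subspace_V ip_linear_right[OF assms(1)] assms(2)]
  by simp_all

lemma ip_zero:
  assumes "w \<in> V"
  shows "ip 0 w = 0" "ip w 0 = 0"
  using linear_form_zero[OF subspace_V ip_linear_left[OF assms] assms]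
    linear_form_zero[OF subspace_V ip_linear_right[OF assms] assms]
  by simp_all

lemmas ip_simps = ip_add_diff ip_scale_minus ip_zero

lemma ip_sum_left: "finite E \<Longrightarrow> (\<And>e. e \<in> E \<Longrightarrow> f e \<in> V) \<Longrightarrow> w \<in> V \<Longrightarrow>
    ip (\<Sum>e\<in>E. f e) w = (\<Sum>e\<in>E. ip (f e) w)"
  by (induction E rule: finite_induct) (auto simp: ip_simps V_closed)

lemma ip_eqI:
  assumes "u \<in> V" "v \<in> V" "\<And>w. w \<in> V \<Longrightarrow> ip u w = ip v w"
  shows "u = v"
proof (rule ccontr)
  assume "u \<noteq> v"
  then have "ip (u - v) (u - v) > 0"
    using assms by (intro ip_pos V_closed) auto
  then show False
    using assms by (simp add: ip_simps V_closed)
qed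

definition orthonormal_set :: "'v set \<Rightarrow> bool" where
  "orthonormal_set B \<longleftrightarrow> finite B \<and> B \<subseteq> V \<and> (\<forall>a\<in>B. \<forall>b\<in>B. ip a b = (if a = b then 1 else 0))"

lemma orthonormal_setD:
  assumes "orthonormal_set B"
  shows "finite B" "B \<subseteq> V" "a \<in> B \<Longrightarrow> a \<in> V" "a \<in> B \<Longrightarrow> ip a a = 1"
    "a \<in> B \<Longrightarrow> b \<in> B \<Longrightarrow> ip a b = (if a = b then 1 else 0)"
  using assms by (auto simp: orthonormal_set_def)

lemma ip_lincomb:
  assumes B: "orthonormal_set B" and b: "b \<in> B"
  shows "ip (\<Sum>a\<in>B. c a *\<^sub>R a) b = c b"
proof -
  have "ip (\<Sum>a\<in>B. c a *\<^sub>R a) b = (\<Sum>a\<in>B. c a * ip a b)"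
    using linear_form_lincomb[OF subspace_V ip_linear_left orthonormal_setD(1,2)[OF B]]
      orthonormal_setD(3)[OF B b] by simp
  also have "\<dots> = (\<Sum>a\<in>B. if a = b then c b else 0)"
    using orthonormal_setD(5)[OF B _ b] by (intro sum.cong) auto
  finally show ?thesis
    using b orthonormal_setD(1)[OF B] by simp
qed

lemma orthonormal_expansion:
  assumes B: "orthonormal_set B" and u: "u \<in> span B"
  shows "u = (\<Sum>b\<in>B. ip u b *\<^sub>R b)"
proof -
  obtain c where c: "u = (\<Sum>b\<in>B. c b *\<^sub>R b)"
    using u orthonormal_setD(1)[OF B] by (auto simp: span_finite)
  then show ?thesis
    using ip_lincomb[OF B] by (simp cong: sum.cong)
qed

lemma linear_form_expansion:
  assumes B: "orthonormal_set B" and u: "u \<in> span B" and f: "linear_form_on V f"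
  shows "(\<Sum>b\<in>B. ip u b * f b) = f u"
  using linear_form_lincomb[OF subspace_V f orthonormal_setD(1,2)[OF B], of "ip u"]
    orthonormal_expansion[OF B u] by simp

lemma orthonormal_card:
  assumes B: "orthonormal_set B"
  shows "card B = dim (span B)"
proof -
  have "independent B"
  proof (rule independent_if_scalars_zero[OF orthonormal_setD(1)[OF B]])
    fix c b assume 0: "(\<Sum>a\<in>B. c a *\<^sub>R a) = 0" and b: "b \<in> B"
    then show "c b = 0"
      using ip_lincomb[OF B b, of c] orthonormal_setD(3)[OF B b] by (simp add: ip_simps(9) V_closed)
  qed
  then show ?thesis
    by (simp add: dim_eq_card_independent dim_span)
qed

text \<open>One Gram-Schmidt step per generator; a generator that already lies in the span of the previous ones
adds nothing.\<close>

lemma ex_orthonormal_basis_finite: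
  assumes "finite F" "F \<subseteq> V"
  shows "\<exists>B. orthonormal_set B \<and> span B = span F"
  using assms
proof (induction F rule: finite_induct)
  case empty
  then show ?case by (intro exI[of _ "{}"]) (simp add: orthonormal_set_def)
next
  case (insert a F)
  then obtain B where B: "orthonormal_set B" "span B = span F" by auto
  note BD = orthonormal_setD[OF B(1)]
  have a: "a \<in> V" using insert.prems by simp
  define p where "p = (\<Sum>b\<in>B. ip a b *\<^sub>R b)"
  define r where "r = a - p"
  have p: "p \<in> span B" "p \<in> V"
    unfolding p_def by (auto intro!: span_sum span_scale V_closed simp: span_base BD(3))
  have r: "r \<in> V" unfolding r_def by (intro V_closed a p)
  have rb: "ip r b = 0" if "b \<in> B" for b
    using ip_lincomb[OF B(1) that, of "ip a"] BD(3)[OF that] a p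
    by (simp add: r_def ip_simps p_def[symmetric])
  have sp: "span (insert a B) = span (insert a F)"
    using B(2) by (simp add: span_insert)
  show ?case
  proof (cases "r = 0")
    case True
    then have "a \<in> span B" using p by (simp add: r_def)
    then have "span B = span (insert a F)"
      using sp span_redundant by metis
    then show ?thesis using B(1) by blast
  next
    case False
    define e where "e = (1 / sqrt (ip r r)) *\<^sub>R r"
    have rr: "ip r r > 0" using ip_pos[OF r False] .
    have e: "e \<in> V" unfolding e_def by (intro V_closed r)
    have ee: "ip e e = 1"
      using rr r by (simp add: e_def ip_simps V_closed field_simps)
    have eb: "ip e b = 0" "ip b e = 0" if "b \<in> B" for b
    proof -
      show "ip e b = 0" using rb[OF that] BD(3)[OF that] r by (simp add: e_def ip_simps)
      then show "ip b e = 0" using ip_commute[OF e BD(3)[OF that]] by simp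
    qed
    have on: "orthonormal_set (insert e B)"
      unfolding orthonormal_set_def using BD e ee eb by force
    have "a = sqrt (ip r r) *\<^sub>R e + p"
      using rr by (simp add: e_def r_def)
    then have "a \<in> span (insert e B)"
      using p(1) span_mono[of B "insert e B"]
      by (metis insertI1 span_add span_base span_scale subsetD subset_insertI)
    moreover have "e \<in> span (insert a B)"
      unfolding e_def r_def using p(1) span_mono[of B "insert a B"]
      by (metis insertI1 span_base span_diff span_scale subsetD subset_insertI)
    ultimately have "span (insert e B) = span (insert a B)"
      by (intro subset_antisym span_minimal) (auto intro: span_base)
    then show ?thesis using on sp by blast
  qed
qed

lemma ex_orthonormal_basis:
  assumes "subspace T" "T \<subseteq> V" "dim T > 0"
  shows "\<exists>B. orthonormal_set B \<and> span B = T \<and> card B = dim T"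
proof -
  obtain F where F: "F \<subseteq> T" "independent F" "T \<subseteq> span F" "card F = dim T"
    using basis_exists by blast
  then have "finite F" using assms(3) card.infinite by fastforce
  then obtain B where B: "orthonormal_set B" "span B = span F"
    using ex_orthonormal_basis_finite F(1) assms(2) by blast
  moreover have "span F = T"
    using F assms(1) by (meson span_minimal subset_antisym)
  ultimately show ?thesis
    using orthonormal_card by metis
qed

text \<open>Expanding each \<open>b\<close> in the first slot over the basis \<open>C\<close> gives a double sum that contracts, over \<open>B\<close>
this time, to the trace over \<open>C\<close>. This is what allows an arbitrarily chosen frame to be replaced by
one adapted to the splitting.\<close>

lemma trace_frame_independent:
  assumes B: "orthonormal_set B" "span B = V" and C: "orthonormal_set C" "span C = V"
    and Q: "bilinear_form_on V Q"
  shows "(\<Sum>b\<in>B. Q b b) = (\<Sum>c\<in>C. Q c c)"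
proof -
  note BD = orthonormal_setD[OF B(1)] and CD = orthonormal_setD[OF C(1)]
  have "(\<Sum>b\<in>B. Q b b) = (\<Sum>b\<in>B. \<Sum>c\<in>C. ip b c * Q c b)"
    using B C BD(3) by (intro sum.cong refl linear_form_expansion[symmetric] bilinear_form_onD(2)[OF Q]) auto
  also have "\<dots> = (\<Sum>c\<in>C. \<Sum>b\<in>B. ip c b * Q c b)"
    by (subst sum.swap) (intro sum.cong refl, simp add: ip_commute BD(3) CD(3))
  also have "\<dots> = (\<Sum>c\<in>C. Q c c)"
    using B C CD(3) by (intro sum.cong refl linear_form_expansion bilinear_form_onD(1)[OF Q]) auto
  finally show ?thesis .
qed

text \<open>Stated for the definite description because that is the form in which the musical isomorphism
\<open>sharp\<close> is defined.\<close>

lemma riesz: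
  assumes B: "orthonormal_set B" "span B = V" and f: "linear_form_on V f"
  shows "(THE v. v \<in> V \<and> (\<forall>w\<in>V. ip v w = f w)) \<in> V"
    and "w \<in> V \<Longrightarrow> ip (THE v. v \<in> V \<and> (\<forall>w\<in>V. ip v w = f w)) w = f w"
proof -
  note BD = orthonormal_setD[OF B(1)]
  define v where "v = (\<Sum>b\<in>B. f b *\<^sub>R b)"
  have v: "v \<in> V" unfolding v_def by (auto intro!: V_closed simp: BD(3))
  have "ip v w = f w" if w: "w \<in> V" for w
  proof -
    have "ip v w = (\<Sum>b\<in>B. f b * ip b w)"
      unfolding v_def by (rule linear_form_lincomb[OF subspace_V ip_linear_left[OF w] BD(1,2)])
    also have "\<dots> = (\<Sum>b\<in>B. ip w b * f b)"
      using w BD(3) by (intro sum.cong refl) (simp add: ip_commute)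
    finally show ?thesis
      using linear_form_expansion[OF B(1) _ f] w B(2) by simp
  qed
  then have "\<exists>!v. v \<in> V \<and> (\<forall>w\<in>V. ip v w = f w)"
    using v by (intro ex1I[of _ v]) (auto intro: ip_eqI)
  from theI'[OF this]
  show "(THE v. v \<in> V \<and> (\<forall>w\<in>V. ip v w = f w)) \<in> V"
    and "w \<in> V \<Longrightarrow> ip (THE v. v \<in> V \<and> (\<forall>w\<in>V. ip v w = f w)) w = f w"
    by blast+
qed

end

section \<open>Curvature tensors on a split Euclidean space\<close>

text \<open>The octahedron argument: the Bianchi identities of the four cyclic shifts of \<open>(X, Y, Z, W)\<close>,
added with the signs \<open>+ + - -\<close>, leave twice the difference of the two sides. The arguments
range over an arbitrary set \<open>F\<close>, because the symmetry is used twice: for vector fields, where it is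
the reason for tensoriality, and then for tangent vectors.\<close>

lemma curvature_pair_symmetry:
  fixes R :: "'a \<Rightarrow> 'a \<Rightarrow> 'a \<Rightarrow> 'a \<Rightarrow> real"
  assumes skew12: "\<And>X Y Z W. X \<in> F \<Longrightarrow> Y \<in> F \<Longrightarrow> Z \<in> F \<Longrightarrow> W \<in> F \<Longrightarrow> R X Y Z W = - R Y X Z W"
    and skew34: "\<And>X Y Z W. X \<in> F \<Longrightarrow> Y \<in> F \<Longrightarrow> Z \<in> F \<Longrightarrow> W \<in> F \<Longrightarrow> R X Y Z W = - R X Y W Z"
    and bianchi: "\<And>X Y Z W. X \<in> F \<Longrightarrow> Y \<in> F \<Longrightarrow> Z \<in> F \<Longrightarrow> W \<in> F \<Longrightarrow>
      R X Y Z W + R Y Z X W + R Z X Y W = 0"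
    and F: "X \<in> F" "Y \<in> F" "Z \<in> F" "W \<in> F"
  shows "R X Y Z W = R Z W X Y"
  using bianchi[OF F(1,2,3,4)] bianchi[OF F(2,3,4,1)] bianchi[OF F(3,4,1,2)] bianchi[OF F(4,1,2,3)]
    skew34[OF F(1,2,3,4)] skew34[OF F(2,3,1,4)] skew34[OF F(3,1,2,4)]
    skew34[OF F(3,4,1,2)] skew34[OF F(4,2,3,1)] skew34[OF F(4,1,2,3)]
    skew12[OF F(3,1,4,2)] skew12[OF F(4,2,1,3)] skew12[OF F(4,2,3,1)] skew12[OF F(1,3,4,2)]
    skew34[OF F(1,3,4,2)] skew34[OF F(2,4,1,3)] skew12[OF F(2,4,1,3)] skew12[OF F(2,4,3,1)]
    skew12[OF F(3,1,2,4)]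
  by linarith

locale curvature_form = inner_subspace V ip
  for V :: "'v::real_vector set" and ip +
  fixes R :: "'v \<Rightarrow> 'v \<Rightarrow> 'v \<Rightarrow> 'v \<Rightarrow> real"
  assumes R_linear4: "X \<in> V \<Longrightarrow> Y \<in> V \<Longrightarrow> Z \<in> V \<Longrightarrow> linear_form_on V (R X Y Z)"
    and R_skew12: "X \<in> V \<Longrightarrow> Y \<in> V \<Longrightarrow> Z \<in> V \<Longrightarrow> W \<in> V \<Longrightarrow> R X Y Z W = - R Y X Z W"
    and R_skew34: "X \<in> V \<Longrightarrow> Y \<in> V \<Longrightarrow> Z \<in> V \<Longrightarrow> W \<in> V \<Longrightarrow> R X Y Z W = - R X Y W Z"
    and R_bianchi: "X \<in> V \<Longrightarrow> Y \<in> V \<Longrightarrow> Z \<in> V \<Longrightarrow> W \<in> V \<Longrightarrow>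
      R X Y Z W + R Y Z X W + R Z X Y W = 0"
begin

lemma R_pair: "X \<in> V \<Longrightarrow> Y \<in> V \<Longrightarrow> Z \<in> V \<Longrightarrow> W \<in> V \<Longrightarrow> R X Y Z W = R Z W X Y"
  by (rule curvature_pair_symmetry[where F = V, OF R_skew12 R_skew34 R_bianchi])

lemma R_linear3: "X \<in> V \<Longrightarrow> Y \<in> V \<Longrightarrow> W \<in> V \<Longrightarrow> linear_form_on V (\<lambda>Z. R X Y Z W)"
  by (rule linear_form_onI) (simp add: R_skew34[of X Y _ W] V_closed linear_form_onD[OF R_linear4])

lemma R_linear1: "Y \<in> V \<Longrightarrow> Z \<in> V \<Longrightarrow> W \<in> V \<Longrightarrow> linear_form_on V (\<lambda>X. R X Y Z W)"
  by (rule linear_form_onI) (simp add: R_pair[of _ Y Z W] V_closed linear_form_onD[OF R_linear3])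

lemma R_linear2: "X \<in> V \<Longrightarrow> Z \<in> V \<Longrightarrow> W \<in> V \<Longrightarrow> linear_form_on V (\<lambda>Y. R X Y Z W)"
  by (rule linear_form_onI) (simp add: R_pair[of X _ Z W] V_closed linear_form_onD[OF R_linear4])

definition ricci_form :: "'v set \<Rightarrow> 'v \<Rightarrow> 'v \<Rightarrow> real" where
  "ricci_form E u v = (\<Sum>e\<in>E. R u e e v)"

lemma ricci_bilinear: "E \<subseteq> V \<Longrightarrow> bilinear_form_on V (ricci_form E)"
  unfolding bilinear_form_on_def ricci_form_def
  by (auto intro!: linear_form_on_sum R_linear4 R_linear1)

lemma schouten_bilinear:
  assumes E: "E \<subseteq> V"
    and P: "\<And>u v. u \<in> V \<Longrightarrow> v \<in> V \<Longrightarrow> P u v = (ricci_form E u v - \<sigma> * ip u v) / c"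
  shows "bilinear_form_on V P"
  unfolding bilinear_form_on_def
proof (intro ballI conjI linear_form_onI)
  fix w x y a assume w: "w \<in> V" "x \<in> V" "y \<in> V"
  show "P w (a *\<^sub>R x + y) = a * P w x + P w y" "P (a *\<^sub>R x + y) w = a * P x w + P y w"
    using w linear_form_onD[OF bilinear_form_onD(1)[OF ricci_bilinear[OF E] w(1)] w(2,3)]
      linear_form_onD[OF bilinear_form_onD(2)[OF ricci_bilinear[OF E] w(1)] w(2,3)]
    by (simp_all add: P V_closed ip_simps add_divide_distrib diff_divide_distrib algebra_simps)
qed

lemma ricci_frame_independent:
  assumes "orthonormal_set E" "span E = V" "orthonormal_set E'" "span E' = V" "u \<in> V" "v \<in> V"
  shows "ricci_form E u v = ricci_form E' u v"
  unfolding ricci_form_def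
  by (rule trace_frame_independent[OF assms(1-4), of "\<lambda>e e'. R u e e' v"])
    (use assms(5,6) in \<open>auto simp: bilinear_form_on_def intro: R_linear2 R_linear3\<close>)

end

text \<open>The situation at one point of a conformal product. The form \<open>b\<close> stands for
\<open>\<nabla>\<theta> - \<theta> \<otimes> \<theta> + |\<theta>|\<^sup>2 g / 2\<close>, so that the left-hand side of \<open>R_mixed\<close> is
\<open>g (R\<^sup>D(X,Y)Z, W)\<close> for the curvature \<open>R\<^sup>D\<close> of the Weyl connection; it vanishes because \<open>D\<close>
preserves \<open>T1\<close>. The antisymmetric part of \<open>b\<close> is half of \<open>d\<theta>\<close>.\<close>

locale split_curvature = curvature_form V ip R
  for V :: "'v::real_vector set" and ip R +
  fixes T1 T2 B1 B2 :: "'v set" and S :: "'v \<Rightarrow> 'v" and b :: "'v \<Rightarrow> 'v \<Rightarrow> real"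
  assumes frame1: "orthonormal_set B1" "span B1 = T1" "B1 \<noteq> {}"
    and frame2: "orthonormal_set B2" "span B2 = T2" "B2 \<noteq> {}"
    and V_split: "V = {u + v | u v. u \<in> T1 \<and> v \<in> T2}"
    and T_orth: "u \<in> T1 \<Longrightarrow> v \<in> T2 \<Longrightarrow> ip u v = 0"
    and S_split: "u \<in> T1 \<Longrightarrow> v \<in> T2 \<Longrightarrow> S (u + v) = u - v"
    and b_bilinear: "bilinear_form_on V b"
    and R_mixed: "X \<in> V \<Longrightarrow> Y \<in> V \<Longrightarrow> Z \<in> T1 \<Longrightarrow> W \<in> T2 \<Longrightarrow>
      R X Y Z W + b X Z * ip Y W - b Y Z * ip X W - ip Y Z * b X W + ip X Z * b Y W = 0"
begin

lemma T_subspace: "subspace T1" "subspace T2"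
  using frame1(2) frame2(2) subspace_span by metis+

lemma T_subset: "u \<in> T1 \<Longrightarrow> u \<in> V" "u \<in> T2 \<Longrightarrow> u \<in> V"
  using subspace_0[OF T_subspace(1)] subspace_0[OF T_subspace(2)]
  unfolding V_split by force+

lemma T_orth': "u \<in> T2 \<Longrightarrow> v \<in> T1 \<Longrightarrow> ip u v = 0"
  using T_orth ip_commute T_subset by metis

lemma V_cases:
  assumes "u \<in> V"
  obtains u1 u2 where "u1 \<in> T1" "u2 \<in> T2" "u = u1 + u2"
  using assms V_split by blast

lemma S_T1: "u \<in> T1 \<Longrightarrow> S u = u" and S_T2: "v \<in> T2 \<Longrightarrow> S v = - v"
  using S_split[of u 0] S_split[of 0 v] subspace_0[OF T_subspace(1)] subspace_0[OF T_subspace(2)]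
  by auto

lemma S_linear:
  assumes "u \<in> V" "v \<in> V"
  shows "S (a *\<^sub>R u + v) = a *\<^sub>R S u + S v"
proof -
  obtain u1 u2 v1 v2 where s: "u1 \<in> T1" "u2 \<in> T2" "u = u1 + u2" "v1 \<in> T1" "v2 \<in> T2" "v = v1 + v2"
    using V_cases[OF assms(1)] V_cases[OF assms(2)] by metis
  have "S ((a *\<^sub>R u1 + v1) + (a *\<^sub>R u2 + v2)) = (a *\<^sub>R u1 + v1) - (a *\<^sub>R u2 + v2)"
    using s T_subspace by (intro S_split subspace_add subspace_scale)
  then show ?thesis
    using s by (simp add: S_split algebra_simps)
qed

lemma S_closed: "u \<in> V \<Longrightarrow> S u \<in> V"
  by (elim V_cases) (auto simp: S_split T_subset intro: V_closed)

lemma linear_form_S: "linear_form_on V f \<Longrightarrow> linear_form_on V (\<lambda>u. f (S u))"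
  by (rule linear_form_onI) (simp add: S_linear linear_form_onD S_closed)

abbreviation "p \<equiv> real (card B1)"
abbreviation "q \<equiv> real (card B2)"

lemma B1_T1: "e \<in> B1 \<Longrightarrow> e \<in> T1" and B2_T2: "e \<in> B2 \<Longrightarrow> e \<in> T2"
  using frame1(2) frame2(2) span_base by blast+

lemma B_disjoint: "B1 \<inter> B2 = {}"
  using B1_T1 B2_T2 T_orth orthonormal_setD(4)[OF frame1(1)] by fastforce

lemma B_frame: "orthonormal_set (B1 \<union> B2)" "span (B1 \<union> B2) = V"
proof -
  show "orthonormal_set (B1 \<union> B2)"
    using frame1(1) frame2(1) B_disjoint unfolding orthonormal_set_def
    by (auto simp: T_orth T_orth' B1_T1 B2_T2)
  show "span (B1 \<union> B2) = V"
    using frame1(2) frame2(2) by (simp add: span_Un V_split)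
qed

lemma sum_frame: "(\<Sum>e\<in>B1 \<union> B2. f e) = (\<Sum>e\<in>B1. f e) + (\<Sum>e\<in>B2. f e :: real)"
  by (intro sum.union_disjoint B_disjoint orthonormal_setD(1)[OF frame1(1)] orthonormal_setD(1)[OF frame2(1)])

lemmas expand1 = linear_form_expansion[OF frame1(1), unfolded frame1(2)]
  and expand2 = linear_form_expansion[OF frame2(1), unfolded frame2(2)]

text \<open>Putting the same unit vector \<open>e\<close> of \<open>T2\<close> in the second and fourth slots of \<open>R_mixed\<close> expresses
\<open>b i k + g(i,k) b(e,e)\<close> as \<open>- R i e k e\<close>, which is symmetric in \<open>i\<close> and \<open>k\<close> by the pair symmetry.
Thus \<open>d\<theta>\<close> has only mixed components.\<close>

lemma b_sym1:
  assumes i: "i \<in> T1" and k: "k \<in> T1"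
  shows "b i k = b k i"
proof -
  obtain e where "e \<in> B2" using frame2(3) by blast
  then have e: "e \<in> T2" "ip e e = 1"
    using B2_T2 orthonormal_setD(4)[OF frame2(1)] by auto
  have "R i e k e = R k e i e"
    using i k e by (intro R_pair T_subset)
  then show ?thesis
    using R_mixed[of i e k e] R_mixed[of k e i e] i k e ip_commute[of i k]
    by (simp add: T_subset T_orth T_orth')
qed

lemma b_sym2:
  assumes i: "i \<in> T2" and k: "k \<in> T2"
  shows "b i k = b k i"
proof -
  obtain e where "e \<in> B1" using frame1(3) by blast
  then have e: "e \<in> T1" "ip e e = 1"
    using B1_T1 orthonormal_setD(4)[OF frame1(1)] by auto
  have "R e i e k = R e k e i"
    using i k e by (intro R_pair T_subset)
  then show ?thesis
    using R_mixed[of e i e k] R_mixed[of e k e i] i k e ip_commute[of i k]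
    by (simp add: T_subset T_orth T_orth')
qed

text \<open>The Ricci trace splits into its two halves over the adapted frame. Their sum is the mixed Ricci
curvature and their difference is the curvature part of \<open>\<K>\<^sub>W\<close>; since \<open>b i k\<close> and \<open>b k i\<close> enter
with the different weights \<open>p - 1\<close> and \<open>q - 1\<close>, the two together determine \<open>b\<close> on mixed
vectors as soon as \<open>p\<close> and \<open>q\<close> are at least \<open>2\<close>.\<close>

lemma partial_traces:
  assumes i: "i \<in> T1" and k: "k \<in> T2"
  shows "(\<Sum>e\<in>B1. R i e e k) = (p - 1) * b i k" "(\<Sum>e\<in>B2. R i e e k) = (q - 1) * b k i"
    "(\<Sum>e\<in>B1. R k e e i) = (p - 1) * b i k" "(\<Sum>e\<in>B2. R k e e i) = (q - 1) * b k i"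
proof -
  have iV: "i \<in> V" and kV: "k \<in> V" using i k T_subset by auto
  have "R i e e k = b i k - ip i e * b e k" if "e \<in> B1" for e
    using R_mixed[of i e e k] that i k B1_T1[OF that] orthonormal_setD(4)[OF frame1(1) that]
    by (simp add: T_subset T_orth)
  then have "(\<Sum>e\<in>B1. R i e e k) = p * b i k - (\<Sum>e\<in>B1. ip i e * b e k)"
    by (simp add: sum_subtractf)
  then show 1: "(\<Sum>e\<in>B1. R i e e k) = (p - 1) * b i k"
    using expand1[OF i bilinear_form_onD(2)[OF b_bilinear kV]] by (simp add: algebra_simps)
  have "R i e e k = b k i - ip k e * b e i" if "e \<in> B2" for e
  proof -
    have "R i e e k = R e k i e"
      using i k B2_T2[OF that] by (intro R_pair T_subset)
    then show ?thesis
      using R_mixed[of e k i e] that i k B2_T2[OF that] orthonormal_setD(4)[OF frame2(1) that]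
      by (simp add: T_subset T_orth' algebra_simps)
  qed
  then have "(\<Sum>e\<in>B2. R i e e k) = q * b k i - (\<Sum>e\<in>B2. ip k e * b e i)"
    by (simp add: sum_subtractf)
  then show 2: "(\<Sum>e\<in>B2. R i e e k) = (q - 1) * b k i"
    using expand2[OF k bilinear_form_onD(2)[OF b_bilinear iV]] by (simp add: algebra_simps)
  \<comment> \<open>the same traces in the other order, by pair symmetry and two sign changes\<close>
  have "R k e e i = R i e e k" if "e \<in> V" for e
    using R_pair[OF kV that that iV] R_skew12[OF that iV kV that] R_skew34[OF iV that kV that]
    by simp
  then show "(\<Sum>e\<in>B1. R k e e i) = (p - 1) * b i k" "(\<Sum>e\<in>B2. R k e e i) = (q - 1) * b k i"
    using 1 2 by (simp_all add: T_subset B1_T1 B2_T2 cong: sum.cong)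
qed

text \<open>A commutator with \<open>S\<close> kills the diagonal blocks of a bilinear form and multiplies the mixed ones by
\<open>\<plusminus> 2\<close>, so only mixed components matter in both identities.\<close>

lemma commutator_form:
  assumes F: "bilinear_form_on V F" and u: "u1 \<in> T1" "u2 \<in> T2" and v: "v1 \<in> T1" "v2 \<in> T2"
  shows "F (u1 + u2) (S (v1 + v2)) - F (S (u1 + u2)) (v1 + v2) = 2 * F u2 v1 - 2 * F u1 v2"
  using assms
  by (simp add: S_split linear_form_add[OF bilinear_form_onD(1)[OF F]] linear_form_diff[OF bilinear_form_onD(1)[OF F]]
      linear_form_add[OF bilinear_form_onD(2)[OF F]] linear_form_diff[OF bilinear_form_onD(2)[OF F]]
      T_subset V_closed)

lemma skew_b_split:
  assumes u: "u1 \<in> T1" "u2 \<in> T2" and v: "v1 \<in> T1" "v2 \<in> T2"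
  shows "b (u1 + u2) (v1 + v2) - b (v1 + v2) (u1 + u2) = (b u1 v2 - b v2 u1) + (b u2 v1 - b v1 u2)"
  using assms b_sym1[OF u(1) v(1)] b_sym2[OF u(2) v(2)]
  by (simp add: linear_form_add[OF bilinear_form_onD(1)[OF b_bilinear]]
      linear_form_add[OF bilinear_form_onD(2)[OF b_bilinear]] T_subset V_closed)

lemma ricci_mixed:
  assumes E: "orthonormal_set E" "span E = V" and i: "i \<in> T1" and k: "k \<in> T2"
  shows "ricci_form E i k = (p - 1) * b i k + (q - 1) * b k i"
    and "ricci_form E k i = (p - 1) * b i k + (q - 1) * b k i"
  using ricci_frame_independent[OF E B_frame] T_subset i k
  by (simp_all add: ricci_form_def sum_frame partial_traces)

text \<open>On \<open>i \<in> T1\<close> and \<open>k \<in> T2\<close> this is the mixed Ricci curvature rewritten as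
\<open>(p + q - 2) s + (p - q) / 2 * d\<close>, where \<open>s\<close> and \<open>d\<close> are \<open>(b i k + b k i) / 2\<close> and \<open>b i k - b k i\<close>.\<close>

lemma ricci_commutator:
  assumes E: "orthonormal_set E" "span E = V" and u: "u \<in> V" and v: "v \<in> V" and pq: "p + q \<noteq> 2"
  shows "(b u (S v) + b (S v) u) / 2 - (b (S u) v + b v (S u)) / 2
    = (p - q) / (p + q - 2) * (b u v - b v u)
      + 1 / (p + q - 2) * (ricci_form E u (S v) - ricci_form E (S u) v)"
proof -
  obtain u1 u2 v1 v2 where s: "u1 \<in> T1" "u2 \<in> T2" "u = u1 + u2" "v1 \<in> T1" "v2 \<in> T2" "v = v1 + v2"
    using V_cases[OF u] V_cases[OF v] by metis
  have EV: "E \<subseteq> V" using orthonormal_setD(2)[OF E(1)] .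
  have 1: "b u (S v) - b (S u) v = 2 * b u2 v1 - 2 * b u1 v2"
    "b v (S u) - b (S v) u = 2 * b v2 u1 - 2 * b v1 u2"
    using s commutator_form[OF b_bilinear] by simp_all
  have 2: "ricci_form E u (S v) - ricci_form E (S u) v = 2 * ricci_form E u2 v1 - 2 * ricci_form E u1 v2"
    using s commutator_form[OF ricci_bilinear[OF EV]] by simp
  have 3: "b u v - b v u = (b u1 v2 - b v2 u1) + (b u2 v1 - b v1 u2)"
    using s skew_b_split by simp
  have n: "p + q - 2 \<noteq> 0" using pq by simp
  have "(b u (S v) + b (S v) u) / 2 - (b (S u) v + b v (S u)) / 2
      = b u2 v1 - b u1 v2 - b v2 u1 + b v1 u2"
    using 1 by (simp add: field_simps)
  moreover have "(p + q - 2) * (b u2 v1 - b u1 v2 - b v2 u1 + b v1 u2)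
    = (p - q) * (b u v - b v u) + (ricci_form E u (S v) - ricci_form E (S u) v)"
    unfolding 2 3 ricci_mixed[OF E s(1,5)] ricci_mixed[OF E s(4,2)] by (simp add: algebra_simps)
  ultimately have "(b u (S v) + b (S v) u) / 2 - (b (S u) v + b v (S u)) / 2
    = ((p - q) * (b u v - b v u) + (ricci_form E u (S v) - ricci_form E (S u) v)) / (p + q - 2)"
    using n by (simp add: nonzero_eq_divide_eq mult.commute)
  then show ?thesis
    by (simp add: add_divide_distrib)
qed

text \<open>When \<open>P\<close> is the Schouten tensor, this is the bilinear form of \<open>\<K>\<^sub>W\<close>: the curvature with the
Kulkarni-Nomizu product of \<open>g\<close> and \<open>P\<close> removed, traced against \<open>S\<close>.\<close>

definition weyl_trace :: "('v \<Rightarrow> 'v \<Rightarrow> real) \<Rightarrow> 'v set \<Rightarrow> 'v \<Rightarrow> 'v \<Rightarrow> real" where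
  "weyl_trace P E u v = (\<Sum>e\<in>E. R u e (S e) v
     - (P e (S e) * ip u v - P u (S e) * ip e v + ip e (S e) * P u v - ip u (S e) * P e v))"

lemma weyl_trace_bilinear:
  assumes P: "bilinear_form_on V P" and E: "E \<subseteq> V"
  shows "bilinear_form_on V (weyl_trace P E)"
  unfolding bilinear_form_on_def weyl_trace_def using E
  by (auto intro!: linear_form_on_sum linear_form_on_arith R_linear4 R_linear1 S_closed
      bilinear_form_onD[OF P] ip_linear_right ip_linear_left)

lemma weyl_trace_frame_independent:
  assumes P: "bilinear_form_on V P"
    and "orthonormal_set E" "span E = V" "orthonormal_set E'" "span E' = V" "u \<in> V" "v \<in> V"
  shows "weyl_trace P E u v = weyl_trace P E' u v"
  unfolding weyl_trace_def
  by (rule trace_frame_independent[OF assms(2-5), of "\<lambda>e e'. R u e (S e') v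
     - (P e (S e') * ip u v - P u (S e') * ip e v + ip e (S e') * P u v - ip u (S e') * P e v)"])
    (use assms(6,7) in \<open>auto simp: bilinear_form_on_def intro!: linear_form_on_arith linear_form_S
      R_linear3 R_linear2 S_closed bilinear_form_onD[OF P] ip_linear_right ip_linear_left\<close>)

text \<open>Of the four Kulkarni-Nomizu terms, the one with \<open>ip u v\<close> vanishes on mixed vectors, the two that
contract \<open>P\<close> with a single frame vector cancel each other, and the trace of \<open>S\<close> gives \<open>p - q\<close>.\<close>

lemma weyl_trace_mixed:
  assumes P: "bilinear_form_on V P" and E: "orthonormal_set E" "span E = V"
    and i: "i \<in> T1" and k: "k \<in> T2"
  shows "weyl_trace P E i k = (p - 1) * b i k - (q - 1) * b k i - (p - q) * P i k"
    and "weyl_trace P E k i = (p - 1) * b i k - (q - 1) * b k i - (p - q) * P k i"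
proof -
  have iV: "i \<in> V" and kV: "k \<in> V" using i k T_subset by auto
  have minus: "P x (- e) = - P x e" "ip x (- e) = - ip x e" if "x \<in> V" "e \<in> V" for x e
    using that linear_form_minus[OF subspace_V bilinear_form_onD(1)[OF P], of x e]
    by (simp_all add: ip_simps(8))
  have R_minus: "R x e (- e) y = - R x e e y" if "x \<in> V" "y \<in> V" "e \<in> V" for x y e
    using that linear_form_minus[OF subspace_V R_linear3, of x e y e] by simp
  define w where "w x e y = R x e (S e) y - (P e (S e) * ip x y - P x (S e) * ip e y
      + ip e (S e) * P x y - ip x (S e) * P e y)" for x e y
  have trace_w: "weyl_trace P E x y = (\<Sum>e\<in>B1. w x e y) + (\<Sum>e\<in>B2. w x e y)"
    if "x \<in> V" "y \<in> V" for x y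
    unfolding weyl_trace_frame_independent[OF P E B_frame that]
    by (simp only: weyl_trace_def w_def sum_frame)
  have 1: "w i e k = R i e e k - P i k + ip i e * P e k"
    "w k e i = R k e e i - P k i + ip i e * P k e" if "e \<in> B1" for e
    using that i k B1_T1[OF that] orthonormal_setD(4)[OF frame1(1) that] ip_commute[of e i]
    by (simp_all add: w_def S_T1 T_orth T_orth' T_subset)
  have 2: "w i e k = - R i e e k + P i k - ip k e * P i e"
    "w k e i = - R k e e i + P k i - ip k e * P e i" if "e \<in> B2" for e
    using that i k B2_T2[OF that] orthonormal_setD(4)[OF frame2(1) that] ip_commute[of e k]
    by (simp_all add: w_def S_T2 minus R_minus T_orth T_orth' T_subset)
  show "weyl_trace P E i k = (p - 1) * b i k - (q - 1) * b k i - (p - q) * P i k"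
    unfolding trace_w[OF iV kV]
    by (simp add: 1 2 sum.distrib sum_subtractf sum_negf partial_traces[OF i k]
        expand1[OF i bilinear_form_onD(2)[OF P kV]] expand2[OF k bilinear_form_onD(1)[OF P iV]]
        left_diff_distrib)
  show "weyl_trace P E k i = (p - 1) * b i k - (q - 1) * b k i - (p - q) * P k i"
    unfolding trace_w[OF kV iV]
    by (simp add: 1 2 sum.distrib sum_subtractf sum_negf partial_traces[OF i k]
        expand1[OF i bilinear_form_onD(1)[OF P kV]] expand2[OF k bilinear_form_onD(2)[OF P iV]]
        left_diff_distrib)
qed

text \<open>The multiples of \<open>ip\<close> in \<open>P\<close> do not contribute to mixed components, so there \<open>P\<close> is
\<open>ric / (p + q - 2)\<close>. Substituting the mixed Ricci curvature and multiplying by \<open>p + q - 2\<close>,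
the coefficients of \<open>b i k\<close> and \<open>b k i\<close> become \<open>(p - 1) (p + q - 2 - (p - q))\<close> and
\<open>- (q - 1) (p + q - 2 + (p - q))\<close>: both
brackets collapse, and the values are opposite. This is why the Weyl tensor sees \<open>d\<theta>\<close> alone,
whatever the Ricci curvature is.\<close>

lemma weyl_commutator:
  assumes E: "orthonormal_set E" "span E = V" and u: "u \<in> V" and v: "v \<in> V"
    and pq: "p \<ge> 2" "q \<ge> 2"
    and P: "\<And>u v. u \<in> V \<Longrightarrow> v \<in> V \<Longrightarrow> P u v = (ricci_form E u v - \<sigma> * ip u v) / (p + q - 2)"
  shows "b u v - b v u = (p + q - 2) / (4 * (p - 1) * (q - 1))
    * (weyl_trace P E (S u) v - weyl_trace P E u (S v))"
proof -
  obtain u1 u2 v1 v2 where s: "u1 \<in> T1" "u2 \<in> T2" "u = u1 + u2" "v1 \<in> T1" "v2 \<in> T2" "v = v1 + v2"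
    using V_cases[OF u] V_cases[OF v] by metis
  have EV: "E \<subseteq> V" using orthonormal_setD(2)[OF E(1)] .
  have Pb: "bilinear_form_on V P"
    using schouten_bilinear[OF EV P] .
  have mixed: "(p + q - 2) * weyl_trace P E i k = 2 * (p - 1) * (q - 1) * (b i k - b k i)"
    "(p + q - 2) * weyl_trace P E k i = 2 * (p - 1) * (q - 1) * (b i k - b k i)"
    if i: "i \<in> T1" and k: "k \<in> T2" for i k
  proof -
    have "(p + q - 2) * P i k = ricci_form E i k" "(p + q - 2) * P k i = ricci_form E k i"
      using pq i k by (simp_all add: P T_subset T_orth T_orth')
    then have e: "(p + q - 2) * ((p - q) * P i k) = (p - q) * ((p - 1) * b i k + (q - 1) * b k i)"
      "(p + q - 2) * ((p - q) * P k i) = (p - q) * ((p - 1) * b i k + (q - 1) * b k i)"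
      using ricci_mixed[OF E i k] by (simp_all add: mult.left_commute)
    show "(p + q - 2) * weyl_trace P E i k = 2 * (p - 1) * (q - 1) * (b i k - b k i)"
      "(p + q - 2) * weyl_trace P E k i = 2 * (p - 1) * (q - 1) * (b i k - b k i)"
      unfolding weyl_trace_mixed[OF Pb E i k] right_diff_distrib[of "p + q - 2" _ "(p - q) * _"] e
      by (simp_all add: algebra_simps)
  qed
  have 1: "weyl_trace P E (S u) v - weyl_trace P E u (S v) = 2 * weyl_trace P E u1 v2 - 2 * weyl_trace P E u2 v1"
    using s commutator_form[OF weyl_trace_bilinear[OF Pb EV] s(1,2,4,5)] by simp
  have 2: "b u v - b v u = (b u1 v2 - b v2 u1) + (b u2 v1 - b v1 u2)"
    using s skew_b_split by simp
  have "(p + q - 2) * (weyl_trace P E (S u) v - weyl_trace P E u (S v))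
      = 2 * ((p + q - 2) * weyl_trace P E u1 v2) - 2 * ((p + q - 2) * weyl_trace P E u2 v1)"
    unfolding 1 by (simp add: algebra_simps)
  also have "\<dots> = 4 * (p - 1) * (q - 1) * (b u v - b v u)"
    unfolding 2 mixed(1)[OF s(1,5)] mixed(2)[OF s(4,2)] by (simp add: algebra_simps)
  finally have "(p + q - 2) * (weyl_trace P E (S u) v - weyl_trace P E u (S v))
    = 4 * (p - 1) * (q - 1) * (b u v - b v u)" .
  moreover have "4 * (p - 1) * (q - 1) \<noteq> 0" using pq by simp
  ultimately show ?thesis
    by (simp add: divide_simps mult.commute)
qed

end

section \<open>Curvature of vector fields and tensoriality\<close>

context inner_subspace begin

text \<open>The pointwise algebra behind the curvature equation of a conformal product. Here \<open>d1, d2, e1, e2\<close>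
are the Weyl derivatives, along \<open>a\<close> and \<open>b\<close>, of a section \<open>z\<close> of \<open>T1\<close> and a section \<open>v\<close> of \<open>T2\<close>;
\<open>z1, z2, v1, v2\<close> are the corresponding Levi-Civita derivatives, \<open>m1, m2\<close> those of the fields \<open>b\<close>
and \<open>a\<close> along \<open>a\<close> and \<open>b\<close>, and the numbers \<open>caz, \<dots>\<close> are values of \<open>\<nabla>\<theta>\<close>. All derivatives cancel
and only \<open>\<nabla>\<theta>\<close>, \<open>\<theta>\<close> and \<open>g\<close> remain.\<close>

lemma mixed_gauss_identity:
  assumes V: "a \<in> V" "b \<in> V" "z \<in> V" "v \<in> V" "\<tau> \<in> V" "d1 \<in> V" "d2 \<in> V" "e1 \<in> V" "e2 \<in> V"
      "m1 \<in> V" "m2 \<in> V"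
    and orth: "ip z v = 0" "ip d1 v = 0" "ip d2 v = 0" "ip z e1 = 0" "ip z e2 = 0" "ip d1 e2 = 0" "ip d2 e1 = 0"
    and z1: "z1 = d1 - (ip \<tau> z *\<^sub>R a + ip \<tau> a *\<^sub>R z - ip a z *\<^sub>R \<tau>)"
    and z2: "z2 = d2 - (ip \<tau> z *\<^sub>R b + ip \<tau> b *\<^sub>R z - ip b z *\<^sub>R \<tau>)"
    and v1: "v1 = e1 - (ip \<tau> v *\<^sub>R a + ip \<tau> a *\<^sub>R v - ip a v *\<^sub>R \<tau>)"
    and v2: "v2 = e2 - (ip \<tau> v *\<^sub>R b + ip \<tau> b *\<^sub>R v - ip b v *\<^sub>R \<tau>)"
  shows "(ip b z * (cav + ip \<tau> v1) + ip \<tau> v * (ip m1 z + ip b z1)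
        - (ip b v * (caz + ip \<tau> z1) + ip \<tau> z * (ip m1 v + ip b v1)) - ip z2 v1)
      - (ip a z * (cbv + ip \<tau> v2) + ip \<tau> v * (ip m2 z + ip a z2)
        - (ip a v * (cbz + ip \<tau> z2) + ip \<tau> z * (ip m2 v + ip a v2)) - ip z1 v2)
      - (ip (m1 - m2) z * ip \<tau> v - ip (m1 - m2) v * ip \<tau> z)
    = - ((caz - ip \<tau> a * ip \<tau> z + ip \<tau> \<tau> / 2 * ip a z) * ip b v
        - (cbz - ip \<tau> b * ip \<tau> z + ip \<tau> \<tau> / 2 * ip b z) * ip a v
        - ip b z * (cav - ip \<tau> a * ip \<tau> v + ip \<tau> \<tau> / 2 * ip a v)
        + ip a z * (cbv - ip \<tau> b * ip \<tau> v + ip \<tau> \<tau> / 2 * ip b v))"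
proof -
  note c = V[THEN ip_commute]
  have comm: "ip b a = ip a b" "ip z a = ip a z" "ip z b = ip b z" "ip v a = ip a v" "ip v b = ip b v"
    "ip a \<tau> = ip \<tau> a" "ip b \<tau> = ip \<tau> b" "ip z \<tau> = ip \<tau> z" "ip v \<tau> = ip \<tau> v" "ip v z = 0"
    "ip d1 \<tau> = ip \<tau> d1" "ip d2 \<tau> = ip \<tau> d2" "ip d1 a = ip a d1" "ip d2 a = ip a d2"
    "ip d1 b = ip b d1" "ip d2 b = ip b d2" "ip e1 z = 0" "ip e2 z = 0" "ip v d1 = 0" "ip v d2 = 0"
    "ip a e1 = ip e1 a" "ip b e1 = ip e1 b" "ip a e2 = ip e2 a" "ip b e2 = ip e2 b"
    "ip \<tau> e1 = ip e1 \<tau>" "ip \<tau> e2 = ip e2 \<tau>"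
    using orth ip_commute V by metis+
  show ?thesis
    unfolding z1 z2 v1 v2
    by (simp add: ip_simps V V_closed orth comm algebra_simps)
qed

end

context riemannian_manifold begin

sublocale tan: inner_subspace "tangent x" "g x" for x
  by unfold_locales (auto simp: subspace_tangent g_linear1 g_pos intro: g_commute)

text \<open>The curvature with its vector fields kept explicit; that it depends only on their values at \<open>x\<close> is
proved below.\<close>

definition field_curvature where
  "field_curvature x X Y Z = nabla x (X x) (\<lambda>y. nabla y (Y y) Z)
     - nabla x (Y x) (\<lambda>y. nabla y (X y) Z) - nabla x (lie_bracket A X Y x) Z"

lemmas nabla_tangent = connection_tangent[OF nabla_connection]
  and field_at_nabla = field_at_connection[OF nabla_connection]
  and nabla_cong = connection_cong[OF nabla_connection]

lemma nabla_minus_dir: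
  assumes "field_at x Y" "u \<in> tangent x"
  shows "nabla x (- u) Y = - nabla x u Y"
  using connection_diff_dir[OF nabla_connection assms(1) subspace_0[OF subspace_tangent] assms(2)]
    connection_diff_dir[OF nabla_connection assms assms(2)] by simp

lemma field_curvature_tangent:
  assumes "field_at x X" "field_at x Y" "field_at x Z"
  shows "field_curvature x X Y Z \<in> tangent x"
  unfolding field_curvature_def using assms
  by (intro tan.V_closed nabla_tangent field_at_nabla lie_bracket_tangent field_at_tangent)

lemma field_curvature_skew12:
  assumes "field_at x X" "field_at x Y" "field_at x Z"
  shows "field_curvature x X Y Z = - field_curvature x Y X Z"
  unfolding field_curvature_def lie_bracket_skew[of X Y x]
  using nabla_minus_dir[OF assms(3) lie_bracket_tangent[OF assms(2,1)]] by simp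

text \<open>Differentiating \<open>g(Z,W)\<close> twice, the terms with one derivative on each factor are symmetric in \<open>X\<close>
and \<open>Y\<close>, so they cancel in \<open>X Y g(Z,W) - Y X g(Z,W) - [X,Y] g(Z,W) = 0\<close>.\<close>

lemma field_curvature_skew34:
  assumes X: "field_at x X" and Y: "field_at x Y" and Z: "field_at x Z" and W: "field_at x W"
  shows "g x (field_curvature x X Y Z) (W x) = - g x (field_curvature x X Y W) (Z x)"
proof -
  let ?f = "\<lambda>y. g y (Z y) (W y)"
  have f: "smooth_at x ?f" using smooth_at_metric[OF Z W] .
  have second: "P x (\<lambda>y. Q y ?f)
      = g x (nabla x (P x) (\<lambda>y. nabla y (Q y) Z)) (W x) + g x (nabla x (Q x) Z) (nabla x (P x) W)
        + (g x (nabla x (P x) Z) (nabla x (Q x) W) + g x (Z x) (nabla x (P x) (\<lambda>y. nabla y (Q y) W)))"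
    if P: "field_at x P" and Q: "field_at x Q" for P Q
  proof -
    have "\<forall>\<^sub>F y in nhds x. Q y ?f = g y (nabla y (Q y) Z) (W y) + g y (Z y) (nabla y (Q y) W)"
      using field_at_eventually[OF Q] field_at_eventually[OF Z] field_at_eventually[OF W]
      by eventually_elim (rule metric_compatible[OF field_at_tangent])
    then have "P x (\<lambda>y. Q y ?f)
        = P x (\<lambda>y. g y (nabla y (Q y) Z) (W y) + g y (Z y) (nabla y (Q y) W))"
      by (rule tangent_cong[OF field_at_tangent[OF P]])
    also have "\<dots> = P x (\<lambda>y. g y (nabla y (Q y) Z) (W y)) + P x (\<lambda>y. g y (Z y) (nabla y (Q y) W))"
      by (rule tangent_add[OF field_at_tangent[OF P]
            smooth_at_metric[OF field_at_nabla[OF Q Z] W] smooth_at_metric[OF Z field_at_nabla[OF Q W]]])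
    finally show ?thesis
      unfolding metric_compatible[OF field_at_tangent[OF P] field_at_nabla[OF Q Z] W]
        metric_compatible[OF field_at_tangent[OF P] Z field_at_nabla[OF Q W]] .
  qed
  have L: "lie_bracket A X Y x \<in> tangent x"
    using lie_bracket_tangent[OF X Y] .
  have "lie_bracket A X Y x ?f
      = g x (nabla x (lie_bracket A X Y x) Z) (W x) + g x (Z x) (nabla x (lie_bracket A X Y x) W)"
    by (rule metric_compatible[OF L Z W])
  then have *: "X x (\<lambda>y. Y y ?f) - Y x (\<lambda>y. X y ?f)
      = g x (nabla x (lie_bracket A X Y x) Z) (W x) + g x (Z x) (nabla x (lie_bracket A X Y x) W)"
    using lie_bracket_smooth[OF f, of X Y] by simp
  note T = field_at_tangent[OF X] field_at_tangent[OF Y] field_at_tangent[OF Z] field_at_tangent[OF W]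
    nabla_tangent[OF Z] nabla_tangent[OF W] L
    nabla_tangent[OF field_at_nabla[OF X Z]] nabla_tangent[OF field_at_nabla[OF X W]]
    nabla_tangent[OF field_at_nabla[OF Y Z]] nabla_tangent[OF field_at_nabla[OF Y W]]
  have "g x (field_curvature x X Y Z) (W x) + g x (Z x) (field_curvature x X Y W) = 0"
    using * unfolding second[OF X Y] second[OF Y X]
    by (simp add: field_curvature_def tan.ip_simps T tan.V_closed)
  then show ?thesis
    using tan.ip_commute[OF T(3) field_curvature_tangent[OF X Y W]] by simp
qed

text \<open>Using that the torsion vanishes twice, once for the inner pair and once for the outer one, the
cyclic sum reduces to the Jacobi identity.\<close>

lemma field_curvature_bianchi:
  assumes X: "field_at x X" and Y: "field_at x Y" and Z: "field_at x Z"
  shows "field_curvature x X Y Z + field_curvature x Y Z X + field_curvature x Z X Y = 0"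
proof -
  have *: "nabla x (P x) (\<lambda>y. nabla y (Q y) R) - nabla x (P x) (\<lambda>y. nabla y (R y) Q)
      = nabla x (lie_bracket A Q R x) P + lie_bracket A P (lie_bracket A Q R) x"
    if P: "field_at x P" and Q: "field_at x Q" and R: "field_at x R" for P Q R
  proof -
    have ev: "\<forall>\<^sub>F y in nhds x. nabla y (Q y) R - nabla y (R y) Q = lie_bracket A Q R y"
      using field_at_eventually[OF Q] field_at_eventually[OF R]
      by eventually_elim (rule torsion_free)
    have "nabla x (P x) (\<lambda>y. nabla y (Q y) R) - nabla x (P x) (\<lambda>y. nabla y (R y) Q)
      = nabla x (P x) (\<lambda>y. nabla y (Q y) R - nabla y (R y) Q)"
      by (rule connection_diff[OF nabla_connection field_at_nabla[OF Q R] field_at_nabla[OF R Q]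
            field_at_tangent[OF P], symmetric])
    also have "\<dots> = nabla x (P x) (lie_bracket A Q R)"
      by (rule nabla_cong[OF field_at_diff[OF field_at_nabla[OF Q R] field_at_nabla[OF R Q]]
            field_at_tangent[OF P] ev])
    finally show ?thesis
      using torsion_free[OF P field_at_lie_bracket[OF Q R]] by (simp add: algebra_simps)
  qed
  have "field_curvature x X Y Z + field_curvature x Y Z X + field_curvature x Z X Y
    = lie_bracket A X (lie_bracket A Y Z) x + lie_bracket A Y (lie_bracket A Z X) x
      + lie_bracket A Z (lie_bracket A X Y) x"
    using *[OF X Y Z] *[OF Y Z X] *[OF Z X Y] unfolding field_curvature_def
    by (simp add: algebra_simps)
  then show ?thesis
    using lie_bracket_jacobi[OF X Y Z] by simp
qed

lemma field_curvature_pair: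
  assumes "field_at x X" "field_at x Y" "field_at x Z" "field_at x W"
  shows "g x (field_curvature x X Y Z) (W x) = g x (field_curvature x Z W X) (Y x)"
proof (rule curvature_pair_symmetry[where F = "Collect (field_at x)"
      and R = "\<lambda>X Y Z W. g x (field_curvature x X Y Z) (W x)"], goal_cases)
  case (1 X Y Z W)
  then show ?case
    using field_curvature_skew12[of x X Y Z] field_curvature_tangent[of x Y X Z]
    by (simp add: tan.ip_simps field_at_tangent)
next
  case (2 X Y Z W)
  then show ?case by (intro field_curvature_skew34) simp_all
next
  case (3 X Y Z W)
  then show ?case
    using arg_cong[OF field_curvature_bianchi[of x X Y Z], of "\<lambda>v. g x v (W x)"]
    by (simp add: tan.ip_simps field_at_tangent field_curvature_tangent tan.V_closed)
qed (use assms in auto)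

text \<open>Tensoriality comes from the symmetries: \<open>g(R(X,Y)Z, W)\<close> obviously depends
only on the value of \<open>W\<close>, and the two skew-symmetries and the pair symmetry move each of the other
fields into that slot.\<close>

lemma field_curvature_tensorial:
  assumes X: "field_at x X" "field_at x X'" "X x = X' x"
    and Y: "field_at x Y" "field_at x Y'" "Y x = Y' x"
    and Z: "field_at x Z" "field_at x Z'" "Z x = Z' x"
    and W: "field_at x W"
  shows "g x (field_curvature x X Y Z) (W x) = g x (field_curvature x X' Y' Z') (W x)"
proof -
  have 3: "g x (field_curvature x P Q Z) (R x) = g x (field_curvature x P Q Z') (R x)"
    if "field_at x P" "field_at x Q" "field_at x R" for P Q R
    using field_curvature_skew34[OF that(1,2) Z(1) that(3)]
      field_curvature_skew34[OF that(1,2) Z(2) that(3)] Z(3) by simp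
  have 1: "g x (field_curvature x X Q P) (R x) = g x (field_curvature x X' Q P) (R x)"
    if "field_at x P" "field_at x Q" "field_at x R" for P Q R
    using field_curvature_skew34[OF that(1,3) X(1) that(2)]
      field_curvature_skew34[OF that(1,3) X(2) that(2)] X(3)
      field_curvature_pair[OF X(1) that(2,1,3)] field_curvature_pair[OF X(2) that(2,1,3)] by simp
  have 2: "g x (field_curvature x P Y Q) (R x) = g x (field_curvature x P Y' Q) (R x)"
    if "field_at x P" "field_at x Q" "field_at x R" for P Q R
    using field_curvature_pair[OF that(1) Y(1) that(2,3)]
      field_curvature_pair[OF that(1) Y(2) that(2,3)] Y(3) by simp
  show ?thesis
    using 1[OF Z(1) Y(1) W] 2[OF X(2) Z(1) W] 3[OF X(2) Y(2) W] by simp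
qed

end

section \<open>Conformal product structures\<close>

context manifold begin

text \<open>Combinations with constant coefficients of a local frame of the distribution suffice; with at least
one field in the frame, its domain is known to be open.\<close>

lemma distribution_section:
  assumes T: "distribution A r T" and r: "r > 0" and v: "v \<in> T x"
  shows "\<exists>Z. field_at x Z \<and> Z x = v \<and> (\<forall>\<^sub>F y in nhds x. Z y \<in> T y)"
proof -
  have "\<exists>U (F :: nat \<Rightarrow> 'm vfield). x \<in> U \<and> (\<forall>i<r. vfield_on A U (F i)) \<and>
      (\<forall>y\<in>U. T y = span ((\<lambda>i. F i y) ` {..<r}))"
    using T by (simp only: distribution_def)
  then obtain U and F :: "nat \<Rightarrow> 'm vfield" where x: "x \<in> U"
    and UF: "\<forall>i<r. vfield_on A U (F i)" "\<forall>y\<in>U. T y = span ((\<lambda>i. F i y) ` {..<r})"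
    by (elim exE conjE) (rule that)
  have F: "vfield_on A U (F i)" if "i < r" for i
    using UF(1) that by blast
  have span: "T y = span ((\<lambda>i. F i y) ` {..<r})" if "y \<in> U" for y
    using UF(2) that by blast
  have U: "open U" using F[OF r] by (simp add: vfield_on_def)
  have sub: "subspace (T y)" for y
    using T by (simp add: distribution_def)
  have v': "v \<in> span ((\<lambda>i. F i x) ` {..<r})"
    using v span[OF x] by simp
  have "\<exists>Z. vfield_on A U Z \<and> Z x = v \<and> (\<forall>y\<in>U. Z y \<in> T y)"
    using v'
  proof (induction rule: span_induct_alt)
    case base
    show ?case
      by (intro exI[of _ "\<lambda>y. 0"] conjI ballI refl vfield_on_zero[OF U] subspace_0[OF sub])
  next
    case (step c w u)
    then obtain Z i where Z: "vfield_on A U Z" "Z x = u" "\<And>y. y \<in> U \<Longrightarrow> Z y \<in> T y"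
      and i: "i < r" "w = F i x" by auto
    have Fi: "F i y \<in> T y" if "y \<in> U" for y
      unfolding span[OF that] using i(1) by (intro span_base) auto
    show ?case
    proof (intro exI conjI ballI)
      show "vfield_on A U (\<lambda>y. c *\<^sub>R F i y + Z y)"
        by (intro vfield_on_add vfield_on_scale smooth_fun_on_const U F i(1) Z(1))
      show "c *\<^sub>R F i x + Z x = c *\<^sub>R w + u"
        using Z(2) i(2) by simp
      show "c *\<^sub>R F i y + Z y \<in> T y" if "y \<in> U" for y
        using that by (intro subspace_add subspace_scale sub Fi Z(3))
    qed
  qed
  then obtain Z where Z: "vfield_on A U Z" "Z x = v" "\<And>y. y \<in> U \<Longrightarrow> Z y \<in> T y" by blast
  moreover have "\<forall>\<^sub>F y in nhds x. Z y \<in> T y"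
    using eventually_nhds_in_open[OF U x] by (rule eventually_mono) (rule Z(3))
  moreover have "field_at x Z"
    using Z(1) x unfolding vfield_at_def by blast
  ultimately show ?thesis by blast
qed

lemma parallel_section:
  assumes T: "parallel A D T" and Y: "field_at x Y" "\<forall>\<^sub>F y in nhds x. Y y \<in> T y"
    and u: "u \<in> tangent x"
  shows "D x u Y \<in> T x"
proof -
  obtain U where U: "x \<in> U" "vfield_on A U Y"
    using Y(1) unfolding vfield_at_def by blast
  obtain W where W: "open W" "x \<in> W" "\<And>y. y \<in> W \<Longrightarrow> Y y \<in> T y"
    using Y(2) unfolding eventually_nhds by blast
  have "open U" using U(2) by (simp add: vfield_on_def)
  then have "vfield_on A (U \<inter> W) Y"
    using W(1) by (intro vfield_on_subset[OF U(2)]) auto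
  then have "\<forall>x\<in>U \<inter> W. \<forall>u\<in>tangent x. D x u Y \<in> T x"
    using T W(3) unfolding parallel_def by (metis IntD2)
  then show ?thesis using U(1) W(2) u by blast
qed

end

locale conformal_product_manifold = riemannian_manifold A g nabla
  for A :: "('m::{t2_space, second_countable_topology}, 'e::euclidean_space) atlas"
    and g :: "'m metric" and nabla :: "'m conn" +
  fixes D :: "'m conn" and \<theta> :: "'m oneform" and p q :: nat and T1 T2 :: "'m \<Rightarrow> 'm tvec set"
  assumes product: "conformal_product A g nabla D \<theta> p T1 q T2"
    and ranks: "p > 0" "q > 0"
begin

lemma product_distributions: "distribution A p T1" "distribution A q T2"
  and tangent_split: "tangent x = {u + v | u v. u \<in> T1 x \<and> v \<in> T2 x}"
  and T_orthogonal: "u \<in> T1 x \<Longrightarrow> v \<in> T2 x \<Longrightarrow> g x u v = 0"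
  and T_parallel: "parallel A D T1" "parallel A D T2"
  and weyl: "weyl_connection A g nabla D \<theta>"
  using product unfolding conformal_product_def by blast+

lemma T_sub: "subspace (T1 x)" "subspace (T2 x)" "T1 x \<subseteq> tangent x" "T2 x \<subseteq> tangent x"
    "dim (T1 x) = p" "dim (T2 x) = q"
  using product_distributions by (simp_all add: distribution_def)

lemma D_connection: "connection A D"
  and theta_one_form: "one_form A \<theta>"
  and D_eq: "u \<in> tangent x \<Longrightarrow> field_at x Y \<Longrightarrow>
    D x u Y = nabla x u Y + \<theta> x (Y x) *\<^sub>R u + \<theta> x u *\<^sub>R Y x - g x u (Y x) *\<^sub>R sharp A g x (\<theta> x)"
  using weyl unfolding weyl_connection_def by blast+

text \<open>Local vector fields through a given tangent vector are obtained from the frames of the two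
distributions, which together span the tangent space.\<close>

lemma tangent_extension:
  assumes "v \<in> tangent x"
  shows "\<exists>X. field_at x X \<and> X x = v"
proof -
  obtain v1 v2 where v: "v1 \<in> T1 x" "v2 \<in> T2 x" "v = v1 + v2"
    using assms tangent_split by blast
  obtain X1 X2 where "field_at x X1" "X1 x = v1" "field_at x X2" "X2 x = v2"
    using distribution_section[OF product_distributions(1) ranks(1) v(1)]
      distribution_section[OF product_distributions(2) ranks(2) v(2)] by blast
  then show ?thesis
    using v(3) by (intro exI[of _ "\<lambda>y. X1 y + X2 y"]) (simp add: field_at_add)
qed

lemma
  assumes "v \<in> tangent x"
  shows field_at_extend: "field_at x (extend A x v)" and extend_at: "extend A x v x = v"
  using someI_ex[OF tangent_extension[OF assms]] unfolding extend_def by blast+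

lemma curvature_eq_field_curvature:
  "curvature A nabla x u v w = field_curvature x (extend A x u) (extend A x v) (extend A x w)"
  by (simp add: curvature_def field_curvature_def Let_def)

lemma curvature_tangent:
  "u \<in> tangent x \<Longrightarrow> v \<in> tangent x \<Longrightarrow> w \<in> tangent x \<Longrightarrow> curvature A nabla x u v w \<in> tangent x"
  by (simp add: curvature_eq_field_curvature field_curvature_tangent field_at_extend)

lemma curvature_of_fields:
  assumes "field_at x X" "field_at x Y" "field_at x Z" "field_at x W"
  shows "g x (curvature A nabla x (X x) (Y x) (Z x)) (W x) = g x (field_curvature x X Y Z) (W x)"
  unfolding curvature_eq_field_curvature
  by (rule field_curvature_tensorial)
    (use assms in \<open>simp_all add: field_at_extend extend_at field_at_tangent\<close>)

sublocale curv: curvature_form "tangent x" "g x" "\<lambda>u v w z. g x (curvature A nabla x u v w) z" for x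
proof unfold_locales
  fix u v w assume uvw: "u \<in> tangent x" "v \<in> tangent x" "w \<in> tangent x"
  show "linear_form_on (tangent x) (g x (curvature A nabla x u v w))"
    by (intro tan.ip_linear_right curvature_tangent uvw)
  fix z assume z: "z \<in> tangent x"
  note F = uvw[THEN field_at_extend] field_at_extend[OF z]
  note e = uvw[THEN extend_at] extend_at[OF z]
  show "g x (curvature A nabla x u v w) z = - g x (curvature A nabla x v u w) z"
    using field_curvature_skew12[OF F(1,2,3)] field_curvature_tangent[OF F(2,1,3)] z
    unfolding curvature_eq_field_curvature by (simp add: tan.ip_simps)
  show "g x (curvature A nabla x u v w) z = - g x (curvature A nabla x u v z) w"
    using field_curvature_skew34[OF F] e unfolding curvature_eq_field_curvature by simp
  show "g x (curvature A nabla x u v w) z + g x (curvature A nabla x v w u) z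
      + g x (curvature A nabla x w u v) z = 0"
    using arg_cong[OF field_curvature_bianchi[OF F(1,2,3)], of "\<lambda>y. g x y z"] z F
    unfolding curvature_eq_field_curvature
    by (simp add: tan.ip_simps field_curvature_tangent tan.V_closed)
qed

lemma frames:
  obtains B1 B2 where "tan.orthonormal_set x B1" "span B1 = T1 x" "card B1 = p"
    "tan.orthonormal_set x B2" "span B2 = T2 x" "card B2 = q"
  using tan.ex_orthonormal_basis[OF T_sub(1,3)] tan.ex_orthonormal_basis[OF T_sub(2,4)] T_sub(5,6) ranks
  by metis

lemma frame_at: "tan.orthonormal_set x (frame_at A g x)" "span (frame_at A g x) = tangent x"
proof -
  obtain B1 B2 where B: "tan.orthonormal_set x B1" "span B1 = T1 x"
    "tan.orthonormal_set x B2" "span B2 = T2 x"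
    using frames by metis
  have "finite (B1 \<union> B2)" "B1 \<union> B2 \<subseteq> tangent x"
    using B by (auto simp: tan.orthonormal_set_def)
  then obtain C where C: "tan.orthonormal_set x C" "span C = span (B1 \<union> B2)"
    using tan.ex_orthonormal_basis_finite by metis
  have "span C = tangent x"
    using B(2,4) C(2) by (simp add: span_Un tangent_split)
  then have "orthonormal_basis A g x C"
    using C(1) by (simp add: orthonormal_basis_def tan.orthonormal_set_def)
  then have *: "orthonormal_basis A g x (frame_at A g x)"
    unfolding frame_at_def by (rule someI)
  then show "span (frame_at A g x) = tangent x"
    by (simp add: orthonormal_basis_def)
  with * show "tan.orthonormal_set x (frame_at A g x)"
    using span_superset[of "frame_at A g x"] by (simp add: orthonormal_basis_def tan.orthonormal_set_def)
qed

lemma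
  assumes "linear_form_on (tangent x) f"
  shows sharp_tangent: "sharp A g x f \<in> tangent x"
    and g_sharp: "w \<in> tangent x \<Longrightarrow> g x (sharp A g x f) w = f w"
  using tan.riesz[OF frame_at assms] unfolding sharp_def by blast+

lemma theta_linear: "linear_form_on (tangent x) (\<theta> x)"
  using theta_one_form unfolding one_form_def linear_form_on_def by blast

lemmas theta_sharp_tangent = sharp_tangent[OF theta_linear]
  and g_theta_sharp = g_sharp[OF theta_linear]

lemma smooth_at_theta:
  assumes "field_at x X"
  shows "smooth_at x (\<lambda>y. \<theta> y (X y))"
proof -
  obtain U where "x \<in> U" "vfield_on A U X"
    using assms unfolding vfield_at_def by blast
  moreover from this have "smooth_fun_on A U (\<lambda>y. \<theta> y (X y))"
    using theta_one_form by (simp add: one_form_def)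
  ultimately show ?thesis
    unfolding smooth_fun_at_def by blast
qed

text \<open>The difference of \<open>D\<close> and \<open>\<nabla>\<close> contains \<open>g(X,X) \<theta>\<^sup>\<sharp>\<close>, and all its other terms are smooth vector
fields. So some multiple of \<open>\<theta>\<^sup>\<sharp>\<close>, by a function that does not vanish at \<open>x\<close>, is a
smooth field, which is as good as the smoothness of \<open>\<theta>\<^sup>\<sharp>\<close> itself for computing \<open>\<nabla>\<theta>\<close>.\<close>

lemma smooth_multiple_of_theta_sharp:
  obtains K h where "field_at x K" "smooth_at x h" "h x \<noteq> 0"
    "\<forall>\<^sub>F y in nhds x. K y = h y *\<^sub>R sharp A g y (\<theta> y)"
proof -
  obtain B where "tan.orthonormal_set x B" "card B = p"
    using frames by metis
  moreover from this obtain v where "v \<in> B"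
    using ranks(1) by fastforce
  ultimately have v: "v \<in> tangent x" "g x v v = 1"
    using tan.orthonormal_setD by blast+
  then obtain X where X: "field_at x X" "X x = v"
    using tangent_extension by blast
  \<comment> \<open>by the Weyl formula, the terms with \<open>\<theta>\<close> cancel and only the one with \<open>sharp\<close> survives\<close>
  define K where "K y = nabla y (X y) X + (2 * \<theta> y (X y)) *\<^sub>R X y - D y (X y) X" for y
  show ?thesis
  proof (rule that)
    show "field_at x K"
      unfolding K_def
      by (intro field_at_diff field_at_add field_at_scale smooth_at_cmult smooth_at_theta
          field_at_nabla field_at_connection[OF D_connection] X)
    show "smooth_at x (\<lambda>y. g y (X y) (X y))"
      by (intro smooth_at_metric X)
    show "g x (X x) (X x) \<noteq> 0"
      using v(2) X(2) by simp
    show "\<forall>\<^sub>F y in nhds x. K y = g y (X y) (X y) *\<^sub>R sharp A g y (\<theta> y)"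
      using field_at_eventually[OF X(1)]
    proof eventually_elim
      case (elim y)
      then show ?case
        unfolding K_def D_eq[OF field_at_tangent[OF elim] elim]
        by (simp add: scaleR_2[symmetric] algebra_simps flip: scaleR_scaleR)
    qed
  qed
qed

text \<open>If \<open>K = h \<theta>\<^sup>\<sharp>\<close>, then comparing \<open>u (h \<theta>(Y))\<close>, computed by the Leibniz rule, with \<open>u (g(K,Y))\<close>,
computed by metric compatibility, expresses \<open>(\<nabla>\<^sub>u \<theta>)(Y)\<close> through the value of \<open>Y\<close> at \<open>x\<close>: this
is the tensoriality of \<open>\<nabla>\<theta>\<close>.\<close>

lemma cov_representation:
  obtains K h where "field_at x K" "smooth_at x h" "h x \<noteq> 0"
    "\<And>u Y. u \<in> tangent x \<Longrightarrow> field_at x Y \<Longrightarrow>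
      u (\<lambda>y. \<theta> y (Y y)) - \<theta> x (nabla x u Y) = (g x (nabla x u K) (Y x) - u h * \<theta> x (Y x)) / h x"
proof -
  obtain K h where K: "field_at x K" "smooth_at x h" "h x \<noteq> 0"
    "\<forall>\<^sub>F y in nhds x. K y = h y *\<^sub>R sharp A g y (\<theta> y)"
    using smooth_multiple_of_theta_sharp .
  have Kx: "K x = h x *\<^sub>R sharp A g x (\<theta> x)"
    using K(4) eventually_nhds_x_imp_x by blast
  have "u (\<lambda>y. \<theta> y (Y y)) - \<theta> x (nabla x u Y) = (g x (nabla x u K) (Y x) - u h * \<theta> x (Y x)) / h x"
    if u: "u \<in> tangent x" and Y: "field_at x Y" for u Y
  proof -
    have "\<forall>\<^sub>F y in nhds x. h y * \<theta> y (Y y) = g y (K y) (Y y)"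
      using K(4) field_at_eventually[OF Y]
      by eventually_elim
        (simp add: tan.ip_simps theta_sharp_tangent field_at_tangent g_theta_sharp)
    then have "u (\<lambda>y. h y * \<theta> y (Y y)) = u (\<lambda>y. g y (K y) (Y y))"
      by (rule tangent_cong[OF u])
    then have "h x * u (\<lambda>y. \<theta> y (Y y)) + \<theta> x (Y x) * u h
        = g x (nabla x u K) (Y x) + h x * \<theta> x (nabla x u Y)"
      unfolding metric_compatible[OF u K(1) Y] tangent_mult[OF u K(2) smooth_at_theta[OF Y]]
      by (simp add: Kx tan.ip_simps theta_sharp_tangent g_theta_sharp nabla_tangent[OF Y u])
    then show ?thesis
      using K(3) by (simp add: field_simps)
  qed
  then show ?thesis using that K by blast
qed

abbreviation "cov \<equiv> cov_form A nabla \<theta>"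

lemma cov_of_field:
  assumes u: "u \<in> tangent x" and Y: "field_at x Y"
  shows "cov x u (Y x) = u (\<lambda>y. \<theta> y (Y y)) - \<theta> x (nabla x u Y)"
proof -
  obtain K h where *: "\<And>u Y. u \<in> tangent x \<Longrightarrow> field_at x Y \<Longrightarrow>
      u (\<lambda>y. \<theta> y (Y y)) - \<theta> x (nabla x u Y) = (g x (nabla x u K) (Y x) - u h * \<theta> x (Y x)) / h x"
    using cov_representation by metis
  note Yx = field_at_tangent[OF Y]
  show ?thesis
    using *[OF u Y] *[OF u field_at_extend[OF Yx]] extend_at[OF Yx]
    by (simp add: cov_form_def Let_def)
qed

lemma cov_bilinear: "bilinear_form_on (tangent x) (cov x)"
proof -
  obtain K h where K: "field_at x K" "smooth_at x h" "h x \<noteq> 0" and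
    *: "\<And>u Y. u \<in> tangent x \<Longrightarrow> field_at x Y \<Longrightarrow>
      u (\<lambda>y. \<theta> y (Y y)) - \<theta> x (nabla x u Y) = (g x (nabla x u K) (Y x) - u h * \<theta> x (Y x)) / h x"
    using cov_representation by metis
  have c: "cov x u v = (g x (nabla x u K) v - u h * \<theta> x v) / h x"
    if "u \<in> tangent x" "v \<in> tangent x" for u v
    using *[OF that(1) field_at_extend[OF that(2)]] extend_at[OF that(2)]
    by (simp add: cov_form_def Let_def)
  show ?thesis
    unfolding bilinear_form_on_def
  proof (intro ballI conjI linear_form_onI)
    fix w u v a assume w: "w \<in> tangent x" "u \<in> tangent x" "v \<in> tangent x"
    have "\<theta> x (a *\<^sub>R u + v) = a * \<theta> x u + \<theta> x v"
      using linear_form_onD[OF theta_linear w(2,3)] .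
    then show "cov x w (a *\<^sub>R u + v) = a * cov x w u + cov x w v"
      using w by (simp add: c tan.V_closed tan.ip_simps nabla_tangent[OF K(1)] add_divide_distrib
          diff_divide_distrib algebra_simps)
    have uv: "a *\<^sub>R u + v \<in> tangent x"
      using w by (intro tan.V_closed)
    have "(a *\<^sub>R u + v) h = a * u h + v h"
      by (simp add: scaleR_fun_def)
    then show "cov x (a *\<^sub>R u + v) w = a * cov x u w + cov x v w"
      unfolding c[OF uv w(1)] c[OF w(2,1)] c[OF w(3,1)]
        connection_linear[OF nabla_connection K(1) w(2,3)]
      using w by (simp add: tan.V_closed tan.ip_simps nabla_tangent[OF K(1)] add_divide_distrib
          diff_divide_distrib algebra_simps)
  qed
qed

lemma ext_deriv_eq_cov:
  assumes u: "u \<in> tangent x" and v: "v \<in> tangent x"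
  shows "ext_deriv A \<theta> x u v = cov x u v - cov x v u"
proof -
  note F = field_at_extend[OF u] field_at_extend[OF v]
  note e = extend_at[OF u] extend_at[OF v]
  have "\<theta> x (nabla x u (extend A x v) - nabla x v (extend A x u))
      = \<theta> x (nabla x u (extend A x v)) - \<theta> x (nabla x v (extend A x u))"
    by (intro linear_form_diff[OF theta_linear] nabla_tangent F u v)
  then show ?thesis
    using torsion_free[OF F] by (simp add: ext_deriv_def cov_form_def Let_def e)
qed

text \<open>Since \<open>D\<close> preserves \<open>T1\<close>, the formula for the Weyl connection gives the component of \<open>\<nabla>\<^sub>u Z\<close> along
\<open>T2\<close>. In particular \<open>T1\<close> is umbilical, and its mean curvature vector is the component of
\<open>\<theta>\<^sup>\<sharp>\<close> in \<open>T2\<close>.\<close>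

lemma second_fundamental_form:
  assumes u: "u \<in> tangent x" and Z: "field_at x Z" "\<forall>\<^sub>F y in nhds x. Z y \<in> T1 y"
    and w: "w \<in> T2 x"
  shows "g x (nabla x u Z) w = g x u (Z x) * \<theta> x w - g x u w * \<theta> x (Z x)"
proof -
  have Zx: "Z x \<in> T1 x"
    using Z(2) eventually_nhds_x_imp_x by blast
  have "D x u Z \<in> T1 x"
    by (rule parallel_section[OF T_parallel(1) Z u])
  then have "g x (D x u Z) w = 0" "g x (Z x) w = 0"
    using w Zx by (auto intro: T_orthogonal)
  then show ?thesis
    using w T_sub(4)[of x] unfolding D_eq[OF u Z(1)]
    by (simp add: subsetD tan.ip_simps tan.V_closed u nabla_tangent[OF Z(1)] field_at_tangent[OF Z(1)]
        theta_sharp_tangent g_theta_sharp algebra_simps)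
qed

text \<open>The tensor by which the Schouten tensor changes when \<open>\<nabla>\<close> is replaced by the Weyl connection with
Lee form \<open>\<theta>\<close>, up to sign and with \<open>\<nabla>\<theta>\<close> not symmetrised.\<close>

definition schouten_shift where
  "schouten_shift x u v = cov x u v - \<theta> x u * \<theta> x v
     + g x (sharp A g x (\<theta> x)) (sharp A g x (\<theta> x)) / 2 * g x u v"

lemma schouten_shift_bilinear: "bilinear_form_on (tangent x) (schouten_shift x)"
  unfolding bilinear_form_on_def schouten_shift_def
  by (intro ballI conjI linear_form_on_arith bilinear_form_onD[OF cov_bilinear] theta_linear
      tan.ip_linear_left tan.ip_linear_right)

text \<open>This is the vanishing of \<open>g(R\<^sup>D(X,Y)Z, W)\<close> for the curvature \<open>R\<^sup>D\<close> of the Weyl connection, written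
with the curvature of \<open>g\<close>. Differentiating the second fundamental form once more, instead of
computing \<open>R\<^sup>D\<close>, only involves the scalar functions \<open>g(Y,Z)\<close> and \<open>\<theta>(W)\<close>, and never a derivative
of \<open>\<theta>\<^sup>\<sharp>\<close>.\<close>

lemma mixed_curvature:
  assumes X: "X \<in> tangent x" and Y: "Y \<in> tangent x" and Z: "Z \<in> T1 x" and W: "W \<in> T2 x"
  shows "g x (curvature A nabla x X Y Z) W + schouten_shift x X Z * g x Y W - schouten_shift x Y Z * g x X W
    - g x Y Z * schouten_shift x X W + g x X Z * schouten_shift x Y W = 0"
proof -
  obtain FX FY where FX: "field_at x FX" "FX x = X" and FY: "field_at x FY" "FY x = Y"
    using tangent_extension X Y by metis
  obtain FZ where FZ: "field_at x FZ" "FZ x = Z" "\<forall>\<^sub>F y in nhds x. FZ y \<in> T1 y"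
    using distribution_section[OF product_distributions(1) ranks(1) Z] by blast
  obtain FW where FW: "field_at x FW" "FW x = W" "\<forall>\<^sub>F y in nhds x. FW y \<in> T2 y"
    using distribution_section[OF product_distributions(2) ranks(2) W] by blast
  have Zt: "Z \<in> tangent x" and Wt: "W \<in> tangent x"
    using Z W T_sub(3,4) by blast+
  \<comment> \<open>differentiating the second fundamental form along \<open>P\<close> isolates the second derivative of \<open>FZ\<close>\<close>
  have second: "g x (nabla x (P x) (\<lambda>y. nabla y (Q y) FZ)) W
      = (g x (Q x) Z * (cov x (P x) W + \<theta> x (nabla x (P x) FW))
          + \<theta> x W * (g x (nabla x (P x) Q) Z + g x (Q x) (nabla x (P x) FZ)))
        - (g x (Q x) W * (cov x (P x) Z + \<theta> x (nabla x (P x) FZ))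
          + \<theta> x Z * (g x (nabla x (P x) Q) W + g x (Q x) (nabla x (P x) FW)))
        - g x (nabla x (Q x) FZ) (nabla x (P x) FW)"
    if P: "field_at x P" and Q: "field_at x Q" for P Q
  proof -
    note u = field_at_tangent[OF P]
    have "\<forall>\<^sub>F y in nhds x. \<forall>\<^sub>F z in nhds y. FZ z \<in> T1 z"
      using FZ(3) by (simp add: eventually_eventually)
    then have "\<forall>\<^sub>F y in nhds x. g y (nabla y (Q y) FZ) (FW y)
        = g y (Q y) (FZ y) * \<theta> y (FW y) - g y (Q y) (FW y) * \<theta> y (FZ y)"
      using field_at_eventually[OF Q] field_at_eventually[OF FZ(1)] FW(3)
      by eventually_elim (rule second_fundamental_form[OF field_at_tangent])
    then have "P x (\<lambda>y. g y (nabla y (Q y) FZ) (FW y))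
        = P x (\<lambda>y. g y (Q y) (FZ y) * \<theta> y (FW y) - g y (Q y) (FW y) * \<theta> y (FZ y))"
      by (rule tangent_cong[OF u])
    also have "\<dots> = P x (\<lambda>y. g y (Q y) (FZ y) * \<theta> y (FW y)) - P x (\<lambda>y. g y (Q y) (FW y) * \<theta> y (FZ y))"
      by (rule tangent_diff[OF u smooth_at_mult[OF smooth_at_metric[OF Q FZ(1)] smooth_at_theta[OF FW(1)]]
          smooth_at_mult[OF smooth_at_metric[OF Q FW(1)] smooth_at_theta[OF FZ(1)]]])
    finally show ?thesis
      unfolding metric_compatible[OF u field_at_nabla[OF Q FZ(1)] FW(1)]
        tangent_mult[OF u smooth_at_metric[OF Q FZ(1)] smooth_at_theta[OF FW(1)]]
        tangent_mult[OF u smooth_at_metric[OF Q FW(1)] smooth_at_theta[OF FZ(1)]]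
        metric_compatible[OF u Q FZ(1)] metric_compatible[OF u Q FW(1)]
      using cov_of_field[OF u FZ(1)] cov_of_field[OF u FW(1)] FZ(2) FW(2) by simp
  qed
  let ?L = "lie_bracket A FX FY x"
  define m1 m2 where "m1 = nabla x X FY" and "m2 = nabla x Y FX"
  have L: "?L = m1 - m2"
    using torsion_free[OF FX(1) FY(1)] FX(2) FY(2) by (simp add: m1_def m2_def)
  have third: "g x (nabla x ?L FZ) W = g x (m1 - m2) Z * \<theta> x W - g x (m1 - m2) W * \<theta> x Z"
    using second_fundamental_form[OF lie_bracket_tangent[OF FX(1) FY(1)] FZ(1,3) W] FZ(2) L by simp
  define \<tau> where "\<tau> = sharp A g x (\<theta> x)"
  have th: "\<theta> x w = g x \<tau> w" if "w \<in> tangent x" for w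
    using g_theta_sharp[OF that] by (simp add: \<tau>_def)
  define z1 z2 v1 v2 where n: "z1 = nabla x X FZ" "z2 = nabla x Y FZ" "v1 = nabla x X FW" "v2 = nabla x Y FW"
  have nt: "z1 \<in> tangent x" "z2 \<in> tangent x" "v1 \<in> tangent x" "v2 \<in> tangent x"
    "m1 \<in> tangent x" "m2 \<in> tangent x" "\<tau> \<in> tangent x"
    by (simp_all add: n m1_def m2_def \<tau>_def nabla_tangent FX(1) FY(1) FZ(1) FW(1) X Y theta_sharp_tangent)
  define d1 d2 e1 e2 where d: "d1 = D x X FZ" "d2 = D x Y FZ" "e1 = D x X FW" "e2 = D x Y FW"
  have dT: "d1 \<in> T1 x" "d2 \<in> T1 x" "e1 \<in> T2 x" "e2 \<in> T2 x"
    unfolding d using parallel_section[OF T_parallel(1) FZ(1,3)] parallel_section[OF T_parallel(2) FW(1,3)] X Y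
    by blast+
  have dt: "d1 \<in> tangent x" "d2 \<in> tangent x" "e1 \<in> tangent x" "e2 \<in> tangent x"
    using dT T_sub(3,4) by blast+
  have nd: "z1 = d1 - (g x \<tau> Z *\<^sub>R X + g x \<tau> X *\<^sub>R Z - g x X Z *\<^sub>R \<tau>)"
    "z2 = d2 - (g x \<tau> Z *\<^sub>R Y + g x \<tau> Y *\<^sub>R Z - g x Y Z *\<^sub>R \<tau>)"
    "v1 = e1 - (g x \<tau> W *\<^sub>R X + g x \<tau> X *\<^sub>R W - g x X W *\<^sub>R \<tau>)"
    "v2 = e2 - (g x \<tau> W *\<^sub>R Y + g x \<tau> Y *\<^sub>R W - g x Y W *\<^sub>R \<tau>)"
    unfolding n d D_eq[OF X FZ(1)] D_eq[OF Y FZ(1)] D_eq[OF X FW(1)] D_eq[OF Y FW(1)] FZ(2) FW(2)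
      th[OF X] th[OF Y] th[OF Zt] th[OF Wt] \<tau>_def[symmetric]
    by (simp_all add: algebra_simps)
  have "g x (curvature A nabla x X Y Z) W = g x (field_curvature x FX FY FZ) W"
    using curvature_of_fields[OF FX(1) FY(1) FZ(1) FW(1)] FX(2) FY(2) FZ(2) FW(2) by simp
  also have "\<dots> = g x (nabla x X (\<lambda>y. nabla y (FY y) FZ)) W - g x (nabla x Y (\<lambda>y. nabla y (FX y) FZ)) W
      - g x (nabla x ?L FZ) W"
    unfolding field_curvature_def FX(2) FY(2)
    by (simp add: tan.ip_simps tan.V_closed Wt X Y nabla_tangent field_at_nabla FX(1) FY(1) FZ(1)
        lie_bracket_tangent)
  also have "\<dots> = (g x Y Z * (cov x X W + g x \<tau> v1) + g x \<tau> W * (g x m1 Z + g x Y z1)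
        - (g x Y W * (cov x X Z + g x \<tau> z1) + g x \<tau> Z * (g x m1 W + g x Y v1)) - g x z2 v1)
      - (g x X Z * (cov x Y W + g x \<tau> v2) + g x \<tau> W * (g x m2 Z + g x X z2)
        - (g x X W * (cov x Y Z + g x \<tau> z2) + g x \<tau> Z * (g x m2 W + g x X v2)) - g x z1 v2)
      - (g x (m1 - m2) Z * g x \<tau> W - g x (m1 - m2) W * g x \<tau> Z)"
    using second[OF FX(1) FY(1)] second[OF FY(1) FX(1)] third
    by (simp only: FX(2) FY(2) n[symmetric] m1_def[symmetric] m2_def[symmetric] th nt Zt Wt)
  also have "\<dots> = - (schouten_shift x X Z * g x Y W - schouten_shift x Y Z * g x X W
    - g x Y Z * schouten_shift x X W + g x X Z * schouten_shift x Y W)"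
    unfolding schouten_shift_def \<tau>_def[symmetric] th[OF X] th[OF Y] th[OF Zt] th[OF Wt]
    by (rule tan.mixed_gauss_identity[OF X Y Zt Wt nt(7) dt nt(5,6) _ _ _ _ _ _ _ nd])
      (use Z W dT in \<open>auto intro: T_orthogonal\<close>)
  finally show ?thesis by simp
qed

abbreviation "S \<equiv> involution T1 T2"

text \<open>The description of \<open>S\<close> has a unique solution because orthogonality makes the sum of \<open>T1\<close> and \<open>T2\<close>
direct.\<close>

lemma involution_split:
  assumes u: "u \<in> T1 x" and v: "v \<in> T2 x"
  shows "S x (u + v) = u - v"
  unfolding involution_def
proof (rule the_equality)
  show "\<exists>a\<in>T1 x. \<exists>b\<in>T2 x. u + v = a + b \<and> u - v = a - b"
    using u v by blast
next
  fix w assume "\<exists>a\<in>T1 x. \<exists>b\<in>T2 x. u + v = a + b \<and> w = a - b"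
  then obtain a b where ab: "a \<in> T1 x" "b \<in> T2 x" "u + v = a + b" "w = a - b" by blast
  then have eq: "u - a = b - v" by (simp add: algebra_simps)
  have "u - a \<in> T1 x" "b - v \<in> T2 x"
    using u v ab T_sub(1,2)[of x] by (auto intro: subspace_diff)
  then have "g x (u - a) (u - a) = 0" "u - a \<in> tangent x"
    using T_orthogonal eq T_sub(3)[of x] by auto
  then have "u - a = 0" using g_pos by fastforce
  then show "w = u - v" using ab eq by simp
qed

end

section \<open>The two commutator identities\<close>

context conformal_product_manifold begin

lemma split_curvature_at:
  assumes "tan.orthonormal_set x B1" "span B1 = T1 x" "card B1 = p"
    "tan.orthonormal_set x B2" "span B2 = T2 x" "card B2 = q"
  shows "split_curvature (tangent x) (g x) (\<lambda>u v w z. g x (curvature A nabla x u v w) z)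
    (T1 x) (T2 x) B1 B2 (S x) (schouten_shift x)"
  using assms ranks
  by unfold_locales (auto simp: T_orthogonal involution_split schouten_shift_bilinear mixed_curvature
      simp flip: tangent_split)

lemma involution_tangent: "u \<in> tangent x \<Longrightarrow> S x u \<in> tangent x"
  and involution_self_adjoint: "u \<in> tangent x \<Longrightarrow> v \<in> tangent x \<Longrightarrow> g x (S x u) v = g x u (S x v)"
proof -
  obtain B1 B2 where "tan.orthonormal_set x B1" "span B1 = T1 x" "card B1 = p"
    "tan.orthonormal_set x B2" "span B2 = T2 x" "card B2 = q"
    using frames .
  then interpret split_curvature "tangent x" "g x" "\<lambda>u v w z. g x (curvature A nabla x u v w) z"
    "T1 x" "T2 x" B1 B2 "S x" "schouten_shift x"
    by (rule split_curvature_at)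
  show "S x u \<in> tangent x" if "u \<in> tangent x" for u
    using S_closed that .
  assume u: "u \<in> tangent x" and v: "v \<in> tangent x"
  then obtain u1 u2 v1 v2 where s: "u1 \<in> T1 x" "u2 \<in> T2 x" "u = u1 + u2"
    "v1 \<in> T1 x" "v2 \<in> T2 x" "v = v1 + v2"
    using V_cases by metis
  show "g x (S x u) v = g x u (S x v)"
    using commutator_form[OF tan.ip_bilinear s(1,2,4,5)] T_orth'[OF s(2,4)] T_orth[OF s(1,5)] s(3,6) by simp
qed

lemma Ric_eq: "Ric A g nabla x u v = curv.ricci_form x (frame_at A g x) u v"
  by (simp add: Ric_def curv.ricci_form_def)

lemma Ric_bilinear: "bilinear_form_on (tangent x) (Ric A g nabla x)"
  using curv.ricci_bilinear[OF tan.orthonormal_setD(2)[OF frame_at(1)]]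
  by (simp add: Ric_eq[abs_def])

lemma schouten_eq:
  "schouten A g nabla x u v = (curv.ricci_form x (frame_at A g x) u v
     - scal A g nabla x / (2 * (real DIM('e) - 1)) * g x u v) / (real DIM('e) - 2)"
  by (simp add: schouten_def Ric_eq)

lemma schouten_bilinear: "bilinear_form_on (tangent x) (schouten A g nabla x)"
  by (rule curv.schouten_bilinear[OF tan.orthonormal_setD(2)[OF frame_at(1)] schouten_eq])

lemma weyl_tensor_tangent:
  assumes "u \<in> tangent x" "v \<in> tangent x" "w \<in> tangent x"
  shows "weyl_tensor A g nabla x u v w \<in> tangent x"
  unfolding weyl_tensor_def Let_def using assms
  by (intro tan.V_closed curvature_tangent sharp_tangent bilinear_form_onD(1)[OF schouten_bilinear])

lemma K_W_tangent: "u \<in> tangent x \<Longrightarrow> K_W A g nabla S x u \<in> tangent x"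
  unfolding K_W_def
  by (intro tan.V_closed(6) weyl_tensor_tangent involution_tangent)
    (auto dest: tan.orthonormal_setD(3)[OF frame_at(1)])

lemma g_K_W:
  assumes u: "u \<in> tangent x" and v: "v \<in> tangent x"
  shows "g x (K_W A g nabla S x u) v = (\<Sum>e\<in>frame_at A g x. g x (curvature A nabla x u e (S x e)) v
    - (schouten A g nabla x e (S x e) * g x u v - schouten A g nabla x u (S x e) * g x e v
      + g x e (S x e) * schouten A g nabla x u v - g x u (S x e) * schouten A g nabla x e v))"
proof -
  note E = tan.orthonormal_setD[OF frame_at(1)]
  have "g x (K_W A g nabla S x u) v
      = (\<Sum>e\<in>frame_at A g x. g x (weyl_tensor A g nabla x u e (S x e)) v)"
    unfolding K_W_def
    by (intro tan.ip_sum_left E(1) weyl_tensor_tangent u involution_tangent E(3) v)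
  also have "\<dots> = (\<Sum>e\<in>frame_at A g x. g x (curvature A nabla x u e (S x e)) v
    - (schouten A g nabla x e (S x e) * g x u v - schouten A g nabla x u (S x e) * g x e v
      + g x e (S x e) * schouten A g nabla x u v - g x u (S x e) * schouten A g nabla x e v))"
  proof (rule sum.cong[OF refl])
    fix e assume "e \<in> frame_at A g x"
    then have e: "e \<in> tangent x" "S x e \<in> tangent x"
      using E(3) involution_tangent by auto
    note P = bilinear_form_onD(1)[OF schouten_bilinear]
    show "g x (weyl_tensor A g nabla x u e (S x e)) v = g x (curvature A nabla x u e (S x e)) v
    - (schouten A g nabla x e (S x e) * g x u v - schouten A g nabla x u (S x e) * g x e v
      + g x e (S x e) * schouten A g nabla x u v - g x u (S x e) * schouten A g nabla x e v)"
      unfolding weyl_tensor_def Let_def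
      by (simp add: tan.ip_simps tan.V_closed u v e curvature_tangent sharp_tangent[OF P]
          g_sharp[OF P])
  qed
  finally show ?thesis .
qed

lemma Theta_tangent: "u \<in> tangent x \<Longrightarrow> Theta A g nabla \<theta> x u \<in> tangent x"
  and g_Theta: "u \<in> tangent x \<Longrightarrow> w \<in> tangent x \<Longrightarrow> g x (Theta A g nabla \<theta> x u) w = cov x u w"
  unfolding Theta_def by (intro sharp_tangent g_sharp bilinear_form_onD(1)[OF cov_bilinear]; assumption)+

lemma
  assumes u: "u \<in> tangent x"
  shows transp_Theta_tangent: "transp A g (Theta A g nabla \<theta>) x u \<in> tangent x"
    and g_transp_Theta: "w \<in> tangent x \<Longrightarrow> g x (transp A g (Theta A g nabla \<theta>) x u) w = cov x w u"
proof -
  have eq: "g x u (Theta A g nabla \<theta> x v) = cov x v u" if "v \<in> tangent x" for v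
    using g_Theta[OF that u] tan.ip_commute[OF u Theta_tangent[OF that]] by simp
  have l: "linear_form_on (tangent x) (\<lambda>v. g x u (Theta A g nabla \<theta> x v))"
    using bilinear_form_onD(2)[OF cov_bilinear u]
    by (auto simp: linear_form_on_def eq tan.V_closed)
  show "transp A g (Theta A g nabla \<theta>) x u \<in> tangent x"
    unfolding transp_def by (rule sharp_tangent[OF l])
  show "g x (transp A g (Theta A g nabla \<theta>) x u) w = cov x w u" if "w \<in> tangent x"
    unfolding transp_def using g_sharp[OF l that] eq[OF that] by simp
qed

lemma Theta_sym_tangent: "u \<in> tangent x \<Longrightarrow> Theta_sym A g nabla \<theta> x u \<in> tangent x"
  unfolding Theta_sym_def by (intro tan.V_closed Theta_tangent transp_Theta_tangent)

lemma g_Theta_sym: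
  "u \<in> tangent x \<Longrightarrow> w \<in> tangent x \<Longrightarrow>
    g x (Theta_sym A g nabla \<theta> x u) w = (cov x u w + cov x w u) / 2"
  by (simp add: Theta_sym_def tan.ip_simps tan.V_closed Theta_tangent transp_Theta_tangent
      g_Theta g_transp_Theta)

lemma ext_deriv_linear:
  assumes u: "u \<in> tangent x"
  shows "linear_form_on (tangent x) (ext_deriv A \<theta> x u)"
  using linear_form_on_add_diff(2)[OF bilinear_form_onD[OF cov_bilinear u]]
  by (auto simp: linear_form_on_def ext_deriv_eq_cov[OF u] tan.V_closed)

lemma ext_deriv_sharp_tangent: "u \<in> tangent x \<Longrightarrow> ext_deriv_sharp A g \<theta> x u \<in> tangent x"
  unfolding ext_deriv_sharp_def by (intro sharp_tangent ext_deriv_linear)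

lemma g_ext_deriv_sharp:
  assumes "u \<in> tangent x" "w \<in> tangent x"
  shows "g x (ext_deriv_sharp A g \<theta> x u) w = schouten_shift x u w - schouten_shift x w u"
  using g_sharp[OF ext_deriv_linear[OF assms(1)] assms(2)] tan.ip_commute[OF assms]
  by (simp add: ext_deriv_sharp_def ext_deriv_eq_cov assms schouten_shift_def)

lemma Ric_sharp_tangent: "u \<in> tangent x \<Longrightarrow> Ric_sharp A g nabla x u \<in> tangent x"
  and g_Ric_sharp: "u \<in> tangent x \<Longrightarrow> w \<in> tangent x \<Longrightarrow>
    g x (Ric_sharp A g nabla x u) w = Ric A g nabla x u w"
  unfolding Ric_sharp_def by (intro sharp_tangent g_sharp bilinear_form_onD(1)[OF Ric_bilinear]; assumption)+

text \<open>Since \<open>S\<close> is self-adjoint, a commutator with \<open>S\<close> translates into the difference of a bilinear form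
evaluated at \<open>(S u, w)\<close> and at \<open>(u, S w)\<close>.\<close>

lemma g_commutator:
  assumes "u \<in> tangent x" "w \<in> tangent x" "\<And>v. v \<in> tangent x \<Longrightarrow> B x v \<in> tangent x"
  shows "g x (commutator B S x u) w = g x (B x (S x u)) w - g x (B x u) (S x w)"
    and "g x (commutator S B x u) w = g x (B x u) (S x w) - g x (B x (S x u)) w"
  using assms by (simp_all add: commutator_def tan.ip_simps tan.V_closed involution_tangent involution_self_adjoint)

lemma commutator_tangent:
  assumes "u \<in> tangent x" "\<And>v. v \<in> tangent x \<Longrightarrow> B x v \<in> tangent x"
  shows "commutator B S x u \<in> tangent x" "commutator S B x u \<in> tangent x"
  using assms by (simp_all add: commutator_def tan.V_closed involution_tangent)

theorem ext_deriv_sharp_eq_weyl_commutator: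
  assumes pq: "p \<ge> 2" "q \<ge> 2" and dim: "DIM('e) = p + q" and u: "u \<in> tangent x"
  shows "ext_deriv_sharp A g \<theta> x u = ((real DIM('e) - 2) / (4 * (real p - 1) * (real q - 1)))
    *\<^sub>R commutator (K_W A g nabla S) S x u"
proof (rule tan.ip_eqI)
  let ?K = "K_W A g nabla S" and ?E = "frame_at A g x"
  obtain B1 B2 where B: "tan.orthonormal_set x B1" "span B1 = T1 x" "card B1 = p"
    "tan.orthonormal_set x B2" "span B2 = T2 x" "card B2 = q"
    using frames .
  then interpret split_curvature "tangent x" "g x" "\<lambda>u v w z. g x (curvature A nabla x u v w) z"
    "T1 x" "T2 x" B1 B2 "S x" "schouten_shift x"
    by (rule split_curvature_at)
  show "ext_deriv_sharp A g \<theta> x u \<in> tangent x"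
    by (rule ext_deriv_sharp_tangent[OF u])
  show "((real DIM('e) - 2) / (4 * (real p - 1) * (real q - 1))) *\<^sub>R commutator ?K S x u \<in> tangent x"
    by (intro tan.V_closed commutator_tangent(1) u K_W_tangent)
  fix w assume w: "w \<in> tangent x"
  have K: "g x (?K x v) z = weyl_trace (schouten A g nabla x) ?E v z"
    if "v \<in> tangent x" "z \<in> tangent x" for v z
    unfolding g_K_W[OF that] weyl_trace_def ..
  have n: "real DIM('e) = real (card B1) + real (card B2)"
    using dim B(3,6) by simp
  have "schouten_shift x u w - schouten_shift x w u = (real (card B1) + real (card B2) - 2)
      / (4 * (real (card B1) - 1) * (real (card B2) - 1))
    * (weyl_trace (schouten A g nabla x) ?E (S x u) w - weyl_trace (schouten A g nabla x) ?E u (S x w))"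
    by (rule weyl_commutator[OF frame_at u w _ _ schouten_eq[unfolded n]])
      (use pq B(3,6) in simp_all)
  then show "g x (ext_deriv_sharp A g \<theta> x u) w
      = g x (((real DIM('e) - 2) / (4 * (real p - 1) * (real q - 1))) *\<^sub>R commutator ?K S x u) w"
    unfolding g_ext_deriv_sharp[OF u w]
    by (simp add: tan.ip_simps g_commutator commutator_tangent u w K_W_tangent K involution_tangent n B(3,6) dim)
qed

theorem theta_commutator_eq_ricci_commutator:
  assumes pq: "p \<ge> 2" "q \<ge> 2" and dim: "DIM('e) = p + q" and u: "u \<in> tangent x"
  shows "S x (Theta_sym A g nabla \<theta> x u) - Theta_sym A g nabla \<theta> x (S x u)
      + wedge g x (sharp A g x (\<theta> x)) (S x (sharp A g x (\<theta> x))) u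
    = ((real p - real q) / (real DIM('e) - 2)) *\<^sub>R ext_deriv_sharp A g \<theta> x u
      + (1 / (real DIM('e) - 2)) *\<^sub>R commutator S (Ric_sharp A g nabla) x u" (is "?l = ?r")
proof (rule tan.ip_eqI)
  let ?R = "Ric_sharp A g nabla" and ?E = "frame_at A g x"
  obtain B1 B2 where B: "tan.orthonormal_set x B1" "span B1 = T1 x" "card B1 = p"
    "tan.orthonormal_set x B2" "span B2 = T2 x" "card B2 = q"
    using frames .
  then interpret split_curvature "tangent x" "g x" "\<lambda>u v w z. g x (curvature A nabla x u v w) z"
    "T1 x" "T2 x" B1 B2 "S x" "schouten_shift x"
    by (rule split_curvature_at)
  note t = u involution_tangent theta_sharp_tangent Theta_sym_tangent
  show "?l \<in> tangent x"
    unfolding wedge_def by (intro tan.V_closed t)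
  show "?r \<in> tangent x"
    by (intro tan.V_closed ext_deriv_sharp_tangent commutator_tangent(2) Ric_sharp_tangent u)
  fix w assume w: "w \<in> tangent x"
  have n: "real DIM('e) = real p + real q" using dim by simp
  have "g x ?l w = (cov x u (S x w) + cov x (S x w) u) / 2 - (cov x (S x u) w + cov x w (S x u)) / 2
      + \<theta> x (S x u) * \<theta> x w - \<theta> x u * \<theta> x (S x w)"
    by (simp add: wedge_def tan.ip_simps tan.V_closed t w involution_self_adjoint g_Theta_sym
        g_theta_sharp)
  also have "\<dots> = (schouten_shift x u (S x w) + schouten_shift x (S x w) u) / 2
      - (schouten_shift x (S x u) w + schouten_shift x w (S x u)) / 2"
    using involution_self_adjoint[OF u w] tan.ip_commute[OF u involution_tangent[OF w]]
      tan.ip_commute[OF w involution_tangent[OF u]]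
    by (simp add: schouten_shift_def field_simps)
  also have "\<dots> = (real p - real q) / (real p + real q - 2) * (schouten_shift x u w - schouten_shift x w u)
      + 1 / (real p + real q - 2) * (Ric A g nabla x u (S x w) - Ric A g nabla x (S x u) w)"
    using ricci_commutator[OF frame_at u w] pq B(3,6) by (simp add: Ric_eq)
  also have "\<dots> = g x ?r w"
    unfolding n g_ext_deriv_sharp[OF u w, symmetric]
    by (simp add: tan.ip_simps tan.V_closed t w g_commutator Ric_sharp_tangent
        ext_deriv_sharp_tangent g_Ric_sharp commutator_tangent)
  finally show "g x ?l w = g x ?r w" .
qed

end

theorem theorem2p6:
  fixes A :: "('m::{t2_space, second_countable_topology}, 'e::euclidean_space) atlas"
    and g :: "'m metric" and nabla D :: "'m conn" and \<theta> :: "'m oneform"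
    and T1 T2 :: "'m \<Rightarrow> 'm tvec set" and p q :: nat
  assumes "smooth_atlas A"
    and "riemannian_metric A g"
    and "levi_civita A g nabla"
    and "conformal_product A g nabla D \<theta> p T1 q T2"
    and "p \<ge> 2" and "q \<ge> 2" and "DIM('e) = p + q"
  shows
    "let n = real DIM('e);
         S = involution T1 T2;
         K = K_W A g nabla S;
         R = Ric_sharp A g nabla;
         \<Theta>s = Theta_sym A g nabla \<theta>;
         d\<theta> = ext_deriv_sharp A g \<theta>;
         \<theta>v = (\<lambda>x. sharp A g x (\<theta> x))
     in (\<forall>x. \<forall>u\<in>tangent_space A x.
           d\<theta> x u = ((n - 2) / (4 * (real p - 1) * (real q - 1))) *\<^sub>R commutator K S x u)
      \<and> (\<forall>x. \<forall>u\<in>tangent_space A x.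
           S x (\<Theta>s x u) - \<Theta>s x (S x u) + wedge g x (\<theta>v x) (S x (\<theta>v x)) u
             = ((real p - real q) / (n - 2)) *\<^sub>R d\<theta> x u + (1 / (n - 2)) *\<^sub>R commutator S R x u)
      \<and> ((\<forall>x. \<forall>u\<in>tangent_space A x. commutator R S x u = 0) \<longrightarrow>
           (\<forall>x. \<forall>u\<in>tangent_space A x.
              (1 / (n - 2)) *\<^sub>R commutator S R x u = 0 \<and>
              S x (\<Theta>s x u) - \<Theta>s x (S x u) + wedge g x (\<theta>v x) (S x (\<theta>v x)) u
                = ((real p - real q) / (n - 2)) *\<^sub>R d\<theta> x u))"
proof -
  interpret conformal_product_manifold A g nabla D \<theta> p q T1 T2
    using assms by unfold_locales auto
  note 1 = ext_deriv_sharp_eq_weyl_commutator[OF assms(5-7)]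
    and 2 = theta_commutator_eq_ricci_commutator[OF assms(5-7)]
  have 3: "commutator S (Ric_sharp A g nabla) x u = 0"
    if "commutator (Ric_sharp A g nabla) S x u = 0" for x u
    using that by (simp add: commutator_def)
  show ?thesis
    unfolding Let_def by (intro conjI allI ballI impI) (simp_all add: 1 2 3)
qed

end
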